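(* Let $\mathcal{H}\in C^1(\mathbb{S}^n)$, and assume that $\mathcal{H}(x_0)=0$ for some $x_0\in \mathbb{S}^n$. Then there are no compact (without boundary) immersed $\mathcal{H}$-hypersurfaces in $\mathbb{R}^{n+1}$.
   Context: Given $\mathcal{H}\in C^1(\mathbb{S}^n)$, an immersed oriented hypersurface $\Sigma$ in $\mathbb{R}^{n+1}$ with unit normal (Gauss map) $\eta:\Sigma\to\mathbb{S}^n$ is called an $\mathcal{H}$-hypersurface (or a hypersurface of prescribed mean curvature $\mathcal{H}$) if its mean curvature function satisfies $H_\Sigma=\mathcal{H}\circ\eta$. The mean curvature is the average of the principal curvatures, with the sign convention that the unit sphere with its inner orientation has mean curvature $1$. *)

theory Defs
  imports "HOL-Analysis.Analysis"
begin

definition C1_on :: "'a::real_normed_vector set \<Rightarrow> ('a \<Rightarrow> 'b::real_normed_vector) \<Rightarrow> bool" where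
  "C1_on U f \<longleftrightarrow>
     (\<exists>f' :: 'a \<Rightarrow> 'a \<Rightarrow>\<^sub>L 'b.
        (\<forall>x\<in>U. (f has_derivative blinfun_apply (f' x)) (at x)) \<and> continuous_on U f')"

definition C2_on :: "'a::real_normed_vector set \<Rightarrow> ('a \<Rightarrow> 'b::real_normed_vector) \<Rightarrow> bool" where
  "C2_on U f \<longleftrightarrow>
     (\<exists>f' :: 'a \<Rightarrow> 'a \<Rightarrow>\<^sub>L 'b.
        (\<forall>x\<in>U. (f has_derivative blinfun_apply (f' x)) (at x)) \<and> C1_on U f')"

text \<open>\<open>C1_on\<close> and \<open>C2_on\<close> are meant for open sets.  On a submanifold of Euclidean space, such as
  the sphere, a function is \<open>C\<^sup>1\<close> if near every point of the submanifold it is the restriction of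
  a \<open>C\<^sup>1\<close> function on an open set of the ambient space.\<close>

definition C1_on_submanifold ::
    "'a::real_normed_vector set \<Rightarrow> ('a \<Rightarrow> 'b::real_normed_vector) \<Rightarrow> bool" where
  "C1_on_submanifold S f \<longleftrightarrow>
     (\<forall>x\<in>S. \<exists>U g. open U \<and> x \<in> U \<and> C1_on U g \<and> (\<forall>y\<in>S \<inter> U. g y = f y))"

text \<open>A chart is a pair of a domain and a map whose values outside the domain are irrelevant.\<close>

type_synonym ('a, 'n) chart = "'a set \<times> ('a \<Rightarrow> real ^ 'n)"

definition is_chart :: "'a topology \<Rightarrow> ('a, 'n::finite) chart \<Rightarrow> bool" where
  "is_chart M c \<longleftrightarrow> (case c of (U, \<phi>) \<Rightarrow>
     openin M U \<and> open (\<phi> ` U) \<and> homeomorphic_map (subtopology M U) (top_of_set (\<phi> ` U)) \<phi>)"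

definition C2_manifold :: "'a topology \<Rightarrow> ('a, 'n::finite) chart set \<Rightarrow> bool" where
  "C2_manifold M A \<longleftrightarrow>
     Hausdorff_space M \<and> second_countable M \<and>
     (\<forall>c\<in>A. is_chart M c) \<and> (\<Union>c\<in>A. fst c) = topspace M \<and>
     (\<forall>(U, \<phi>)\<in>A. \<forall>(V, \<theta>)\<in>A. C2_on (\<phi> ` (U \<inter> V)) (\<theta> \<circ> inv_into U \<phi>))"

text \<open>The expression of a map in a chart.\<close>

definition in_chart :: "('a, 'n::finite) chart \<Rightarrow> ('a \<Rightarrow> 'b) \<Rightarrow> real ^ 'n \<Rightarrow> 'b" where
  "in_chart c f = f \<circ> inv_into (fst c) (snd c)"

definition C2_immersion ::
    "('a, 'n::finite) chart set \<Rightarrow> ('a \<Rightarrow> real ^ 'm::finite) \<Rightarrow> bool" where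
  "C2_immersion A \<psi> \<longleftrightarrow>
     (\<forall>(U, \<phi>)\<in>A. C2_on (\<phi> ` U) (in_chart (U, \<phi>) \<psi>) \<and>
        (\<forall>y\<in>\<phi> ` U. inj (frechet_derivative (in_chart (U, \<phi>) \<psi>) (at y))))"

text \<open>An orientation of the hypersurface is a choice of a unit normal vector field of class
  \<open>C\<^sup>1\<close>, the natural class for the normal of a \<open>C\<^sup>2\<close> immersion.\<close>

definition is_gauss_map ::
    "'a topology \<Rightarrow> ('a, 'n::finite) chart set \<Rightarrow> ('a \<Rightarrow> real ^ 'm::finite) \<Rightarrow>
       ('a \<Rightarrow> real ^ 'm) \<Rightarrow> bool" where
  "is_gauss_map M A \<psi> \<eta> \<longleftrightarrow>
     \<eta> ` topspace M \<subseteq> sphere 0 1 \<and>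
     (\<forall>(U, \<phi>)\<in>A. C1_on (\<phi> ` U) (in_chart (U, \<phi>) \<eta>) \<and>
        (\<forall>y\<in>\<phi> ` U. \<forall>v.
           in_chart (U, \<phi>) \<eta> y \<bullet> frechet_derivative (in_chart (U, \<phi>) \<psi>) (at y) v = 0))"

definition immersed_oriented_hypersurface ::
    "'a topology \<Rightarrow> ('a, 'n::finite) chart set \<Rightarrow> ('a \<Rightarrow> real ^ 'm::finite) \<Rightarrow>
       ('a \<Rightarrow> real ^ 'm) \<Rightarrow> bool" where
  "immersed_oriented_hypersurface M A \<psi> \<eta> \<longleftrightarrow>
     CARD('m) = CARD('n) + 1 \<and> topspace M \<noteq> {} \<and>
     C2_manifold M A \<and> C2_immersion A \<psi> \<and> is_gauss_map M A \<psi> \<eta>"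

text \<open>Let \<open>X\<close> be a local parametrization with unit normal \<open>N\<close>.  Pulled back to the parameter
  domain, the equation \<open>S w = \<kappa> w\<close> for the shape operator \<open>S = - d\<eta>\<close> and a tangent vector
  \<open>w = dX v\<close> reads \<open>- dN v = \<kappa> dX v\<close>.\<close>

definition principal_space ::
    "(real ^ 'n::finite \<Rightarrow> real ^ 'm::finite) \<Rightarrow> (real ^ 'n \<Rightarrow> real ^ 'm) \<Rightarrow> real ^ 'n \<Rightarrow>
       real \<Rightarrow> (real ^ 'n) set" where
  "principal_space X N y \<kappa> =
     {v. - frechet_derivative N (at y) v = \<kappa> *\<^sub>R frechet_derivative X (at y) v}"

definition principal_curvatures ::
    "(real ^ 'n::finite \<Rightarrow> real ^ 'm::finite) \<Rightarrow> (real ^ 'n \<Rightarrow> real ^ 'm) \<Rightarrow> real ^ 'n \<Rightarrow>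
       real set" where
  "principal_curvatures X N y = {\<kappa>. \<exists>v\<in>principal_space X N y \<kappa>. v \<noteq> 0}"

text \<open>The average takes multiplicities into account.  As \<open>S\<close> is self-adjoint, they are
  the dimensions of the eigenspaces and add up to \<open>n\<close>.\<close>

definition mean_curvature ::
    "(real ^ 'n::finite \<Rightarrow> real ^ 'm::finite) \<Rightarrow> (real ^ 'n \<Rightarrow> real ^ 'm) \<Rightarrow> real ^ 'n \<Rightarrow>
       real" where
  "mean_curvature X N y =
     (\<Sum>\<kappa>\<in>principal_curvatures X N y. real (dim (principal_space X N y \<kappa>)) * \<kappa>) / real CARD('n)"

text \<open>The mean curvature at a point does not depend on the chart around it.\<close>

definition prescribed_mean_curvature_hypersurface ::
    "(real ^ 'm::finite \<Rightarrow> real) \<Rightarrow> 'a topology \<Rightarrow> ('a, 'n::finite) chart set \<Rightarrow>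
       ('a \<Rightarrow> real ^ 'm) \<Rightarrow> ('a \<Rightarrow> real ^ 'm) \<Rightarrow> bool" where
  "prescribed_mean_curvature_hypersurface \<H> M A \<psi> \<eta> \<longleftrightarrow>
     immersed_oriented_hypersurface M A \<psi> \<eta> \<and>
     (\<forall>(U, \<phi>)\<in>A. \<forall>p\<in>U.
        mean_curvature (in_chart (U, \<phi>) \<psi>) (in_chart (U, \<phi>) \<eta>) (\<phi> p) = \<H> (\<eta> p))"

text \<open>Sign convention: the unit sphere with its inner orientation has mean curvature 1.\<close>

lemma mean_curvature_unit_sphere_inner:
  fixes X :: "real ^ 'n::finite \<Rightarrow> real ^ 'm::finite"
  assumes diff: "X differentiable (at y)" and inj: "inj (frechet_derivative X (at y))"
  shows "mean_curvature X (\<lambda>z. - X z) y = 1"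
proof -
  let ?D = "frechet_derivative X (at y)"
  have D: "(X has_derivative ?D) (at y)"
    using diff frechet_derivative_works by blast
  have "((\<lambda>z. - X z) has_derivative (\<lambda>v. - ?D v)) (at y)"
    using D by (rule has_derivative_minus)
  then have N: "frechet_derivative (\<lambda>z. - X z) (at y) = (\<lambda>v. - ?D v)"
    by (rule frechet_derivative_at[symmetric])
  have "?D 0 = 0"
    using D has_derivative_linear linear_0 by blast
  then have nz: "?D v \<noteq> 0" if "v \<noteq> 0" for v
    using inj that by (metis injD)
  have eq: "?D v = \<kappa> *\<^sub>R ?D v \<longleftrightarrow> \<kappa> = 1" if "v \<noteq> 0" for v \<kappa>
    using nz[OF that] by (metis scaleR_cancel_right scaleR_one)
  have "\<exists>v :: real ^ 'n. v \<noteq> 0"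
    by (rule exI[of _ 1]) simp
  then have "principal_curvatures X (\<lambda>z. - X z) y = {1}"
    unfolding principal_curvatures_def principal_space_def N using eq by auto
  moreover have "principal_space X (\<lambda>z. - X z) y 1 = UNIV"
    unfolding principal_space_def N by simp
  ultimately show ?thesis
    by (simp add: mean_curvature_def)
qed

end

theory Submission
  imports Defs
begin

text \<open>Let \<open>f = \<psi> \<bullet> e\<close> be the height of a compact hypersurface \<open>\<Sigma>\<close> in direction \<open>e = \<plusminus> x0\<close>.  Where \<open>f\<close> is
  maximal the normal is \<open>\<plusminus> e\<close>, and there the Hessian of \<open>f\<close> is \<open>\<eta> \<bullet> e\<close> times the second fundamental
  form, so \<open>\<H> e \<le> 0\<close> or \<open>\<H> (- e) \<ge> 0\<close> according to the sign.  The Gauss map need not be onto (a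
  figure eight rotated about an axis can avoid a neighbourhood of one of the two axis directions), so it
  may miss \<open>x0\<close>.
  But if \<open>\<eta> = - x0\<close> both at a highest and at a lowest point, then \<open>\<H> (- x0)\<close> is both \<open>\<ge> 0\<close> and
  \<open>\<le> 0\<close>.  Hence in every case \<open>\<H> (\<eta> p) = 0\<close> at a point \<open>p\<close> where one of the two heights is maximal.

  There \<open>\<Sigma>\<close> touches, from one side and with the same normal, its tangent hyperplane, which also
  has prescribed mean curvature \<open>\<H>\<close>.  The strong maximum principle shows that \<open>f\<close> is constant near
  \<open>p\<close> (\<open>height_locally_constant_at_max\<close>).  It applies to \<open>f\<close> directly, without writing \<open>\<Sigma>\<close> as a
  graph.  Choose at each point an orthonormal frame of principal directions \<open>v\<close>, given by the spectral
  theorem for the shape operator.  The sum of the second derivatives of \<open>f\<close> along these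
  directions is \<open>n H (\<eta> \<bullet> e)\<close> plus a term controlled by the tangential part of \<open>e\<close>, which is the
  gradient of \<open>f\<close> on \<open>\<Sigma>\<close>; and \<open>\<bar>H\<bar> = \<bar>\<H> \<circ> \<eta>\<bar>\<close> is controlled by the distance of \<open>\<eta>\<close> from \<open>\<eta> p\<close>, hence again
  by the gradient, because \<open>\<H>\<close> is \<open>C\<^sup>1\<close> and vanishes at \<open>\<eta> p\<close>.  So \<open>f\<close> satisfies an elliptic
  differential inequality without a term of order zero.

  Consequently the points where \<open>f\<close> is maximal and \<open>\<eta> = \<eta> p\<close> form a set \<open>K\<close> that is open and compact.
  On \<open>K\<close> the height in a direction \<open>u\<close> orthogonal to \<open>e\<close> attains its maximum; as \<open>K\<close> is open, the
  normal there is \<open>\<plusminus> u\<close>, although it is \<open>\<plusminus> e\<close> all over \<open>K\<close>.  This contradiction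
  (\<open>no_height_max_with_zero_curvature\<close>) proves the theorem.\<close>

section \<open>Symmetry of the second derivative\<close>

text \<open>The second difference \<open>\<Delta> s u v\<close> is symmetric in \<open>u\<close> and \<open>v\<close>.  By the mean value theorem in
  direction \<open>v\<close> it is \<open>s\<close> times an increment of \<open>f'\<close> over \<open>s u\<close>, so that \<open>\<Delta> s u v / s\<^sup>2\<close> tends to the
  second derivative.\<close>

lemma second_derivative_symmetric:
  fixes f :: "'a::real_normed_vector \<Rightarrow> real" and f' :: "'a \<Rightarrow> 'a \<Rightarrow>\<^sub>L real"
  assumes S: "open S" "y \<in> S"
    and f: "\<And>x. x \<in> S \<Longrightarrow> (f has_derivative f' x) (at x)"
    and f': "(f' has_derivative f'') (at y)"
  shows "blinfun_apply (f'' u) v = blinfun_apply (f'' v) u"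
proof -
  define \<Delta> where "\<Delta> s a b = f (y + s *\<^sub>R a + s *\<^sub>R b) - f (y + s *\<^sub>R a) - f (y + s *\<^sub>R b) + f y"
    for s a b
  have lin: "linear f''"
    using f' has_derivative_linear by blast
  have main: "((\<lambda>s. \<Delta> s a b / s\<^sup>2) \<longlongrightarrow> blinfun_apply (f'' a) b) (at_right 0)" for a b
  proof (rule tendstoI)
    fix e :: real assume e: "e > 0"
    \<comment> \<open>The factor that makes the two remainder terms add up to less than \<open>e * s\<close>.\<close>
    define k where "k = 2 * (norm a + norm b + 1) * (norm b + 1)"
    have k: "k > 0" by (auto simp: k_def intro!: mult_pos_pos add_nonneg_pos)
    obtain d1 where d1: "d1 > 0" "ball y d1 \<subseteq> S"
      using S openE by blast
    obtain d2 where d2: "d2 > 0" and d2': "\<And>x. norm (x - y) < d2 \<Longrightarrow>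
        norm (f' x - f' y - f'' (x - y)) \<le> (e / (2 * k)) * norm (x - y)"
      using f' unfolding has_derivative_at_alt
      by (metis e k divide_pos_pos mult_pos_pos zero_less_numeral)
    define d where "d = min d1 d2 / (norm a + norm b + 1)"
    have nn: "norm a + norm b + 1 > 0" by (simp add: add_nonneg_pos)
    have d: "d > 0" using d1 d2 nn by (simp add: d_def)
    have "dist (\<Delta> s a b / s\<^sup>2) (blinfun_apply (f'' a) b) < e" if s: "0 < s" "s < d" for s
    proof -
      have sm: "s * (norm a + norm b + 1) < min d1 d2"
        using s nn by (simp add: d_def field_simps)
      have small: "norm (c *\<^sub>R a + t *\<^sub>R b) \<le> s * (norm a + norm b + 1)"
        if "0 \<le> t" "t \<le> s" "0 \<le> c" "c \<le> s" for t c
      proof -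
        have "norm (c *\<^sub>R a + t *\<^sub>R b) \<le> norm (c *\<^sub>R a) + norm (t *\<^sub>R b)" by (rule norm_triangle_ineq)
        also have "\<dots> = c * norm a + t * norm b" using that by simp
        also have "\<dots> \<le> s * norm a + s * norm b"
          using that by (intro add_mono mult_right_mono) auto
        also have "\<dots> \<le> s * (norm a + norm b + 1)" using s by (simp add: algebra_simps)
        finally show ?thesis .
      qed
      have inS: "y + c *\<^sub>R a + t *\<^sub>R b \<in> S" if "0 \<le> t" "t \<le> s" "0 \<le> c" "c \<le> s" for t c
      proof -
        have "norm (c *\<^sub>R a + t *\<^sub>R b) < d1" using small[OF that] sm by linarith
        moreover have "dist (y + (c *\<^sub>R a + t *\<^sub>R b)) y = norm (c *\<^sub>R a + t *\<^sub>R b)"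
          by (simp add: dist_norm)
        ultimately have "y + c *\<^sub>R a + t *\<^sub>R b \<in> ball y d1"
          by (simp add: dist_commute add.assoc)
        then show ?thesis using d1 by blast
      qed
      define g where "g t = f (y + s *\<^sub>R a + t *\<^sub>R b) - f (y + 0 *\<^sub>R a + t *\<^sub>R b)" for t
      define g' where "g' t = blinfun_apply (f' (y + s *\<^sub>R a + t *\<^sub>R b)) b
        - blinfun_apply (f' (y + 0 *\<^sub>R a + t *\<^sub>R b)) b" for t
      have der: "((\<lambda>t. f (y + c *\<^sub>R a + t *\<^sub>R b)) has_real_derivative
          blinfun_apply (f' (y + c *\<^sub>R a + t *\<^sub>R b)) b) (at t)"
        if "0 \<le> t" "t \<le> s" "0 \<le> c" "c \<le> s" for t c
      proof -
        have "((\<lambda>t. y + c *\<^sub>R a + t *\<^sub>R b) has_derivative (\<lambda>h. h *\<^sub>R b)) (at t)"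
          by (auto intro!: derivative_eq_intros)
        from has_derivative_compose[OF this f[OF inS[OF that]]]
        have "((\<lambda>t. f (y + c *\<^sub>R a + t *\<^sub>R b)) has_derivative
          (\<lambda>h. blinfun_apply (f' (y + c *\<^sub>R a + t *\<^sub>R b)) (h *\<^sub>R b))) (at t)" .
        then show ?thesis
          by (simp add: has_field_derivative_def blinfun.scaleR_right mult.commute[of _ "blinfun_apply _ _"] cong: )
      qed
      have gder: "(g has_real_derivative g' t) (at t)" if "0 \<le> t" "t \<le> s" for t
        unfolding g_def g'_def using that s by (intro DERIV_diff der) auto
      obtain \<xi> where \<xi>: "0 < \<xi>" "\<xi> < s" and mv: "g s - g 0 = (s - 0) * g' \<xi>"
        using MVT2[of 0 s g g'] s gder by auto
      have D: "\<Delta> s a b = s * g' \<xi>"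
        using mv by (simp add: \<Delta>_def g_def)
      define R where "R c = f' (y + c *\<^sub>R a + \<xi> *\<^sub>R b) - f' y - f'' (c *\<^sub>R a + \<xi> *\<^sub>R b)" for c
      have R: "norm (R c) \<le> (e / (2 * k)) * (s * (norm a + norm b + 1))" if "0 \<le> c" "c \<le> s" for c
      proof -
        have le: "norm (c *\<^sub>R a + \<xi> *\<^sub>R b) \<le> s * (norm a + norm b + 1)"
          using small[of \<xi> c] that \<xi> by simp
        then have "norm ((y + c *\<^sub>R a + \<xi> *\<^sub>R b) - y) < d2"
          using sm by (simp add: add.assoc)
        from d2'[OF this] have "norm (R c) \<le> (e / (2 * k)) * norm (c *\<^sub>R a + \<xi> *\<^sub>R b)"
          by (simp add: R_def add.assoc)
        also have "\<dots> \<le> (e / (2 * k)) * (s * (norm a + norm b + 1))"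
          using le e k by (intro mult_left_mono) auto
        finally show ?thesis .
      qed
      have "g' \<xi> = blinfun_apply (R s - R 0 + s *\<^sub>R f'' a) b"
        by (simp add: g'_def R_def linear_add[OF lin] linear_scale[OF lin] blinfun.diff_left
            blinfun.add_left blinfun.scaleR_left)
      then have "g' \<xi> - s * blinfun_apply (f'' a) b = blinfun_apply (R s - R 0) b"
        by (simp add: blinfun.add_left blinfun.scaleR_left)
      then have "\<bar>g' \<xi> - s * blinfun_apply (f'' a) b\<bar> \<le> norm (R s - R 0) * norm b"
        using norm_blinfun[of "R s - R 0" b] by simp
      also have "\<dots> \<le> (norm (R s) + norm (R 0)) * norm b"
        by (intro mult_right_mono norm_triangle_ineq4) auto
      also have "\<dots> \<le> (2 * ((e / (2 * k)) * (s * (norm a + norm b + 1)))) * (norm b + 1)"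
      proof (intro mult_mono)
        show "norm (R s) + norm (R 0) \<le> 2 * ((e / (2 * k)) * (s * (norm a + norm b + 1)))"
          using R[of s] R[of 0] s by linarith
      qed (use s e k nn in auto)
      also have "\<dots> = e * s / 2"
        using k nn by (simp add: k_def field_simps)
      also have "\<dots> < e * s" using e s by simp
      finally have *: "\<bar>g' \<xi> - s * blinfun_apply (f'' a) b\<bar> < e * s" .
      have "\<Delta> s a b / s\<^sup>2 - blinfun_apply (f'' a) b = (g' \<xi> - s * blinfun_apply (f'' a) b) / s"
        using s by (simp add: D field_simps power2_eq_square)
      then show ?thesis
        using * s by (simp add: dist_real_def abs_divide pos_divide_less_eq)
    qed
    then show "\<forall>\<^sub>F s in at_right 0. dist (\<Delta> s a b / s\<^sup>2) (blinfun_apply (f'' a) b) < e"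
      using d unfolding eventually_at_right_field by blast
  qed
  have "\<Delta> s u v = \<Delta> s v u" for s
    by (simp add: \<Delta>_def algebra_simps)
  then have "((\<lambda>s. \<Delta> s v u / s\<^sup>2) \<longlongrightarrow> blinfun_apply (f'' u) v) (at_right 0)"
    using main[of u v] by simp
  then show ?thesis
    using main[of v u] tendsto_unique trivial_limit_at_right_real by blast
qed

section \<open>The spectral theorem for symmetric operators\<close>

text \<open>A unit vector \<open>b\<close> of \<open>T\<close> at which the quadratic form \<open>Q\<close> is maximal is an eigenvector: perturbing it
  by \<open>t w\<close> with \<open>w \<bottom> b\<close> changes \<open>Q\<close> to first order by \<open>2 t (S b \<bullet> w)\<close>, which must therefore
  vanish.  The orthogonal complement of \<open>b\<close> in \<open>T\<close> is then invariant, and induction on the dimension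
  applies.  A subspace \<open>T\<close> instead of the whole space serves both this induction and the tangent spaces
  below.\<close>

lemma spectral_theorem:
  fixes S :: "'a::euclidean_space \<Rightarrow> 'a"
  assumes "subspace T" "linear S" "S ` T \<subseteq> T"
    and "\<And>u w. u \<in> T \<Longrightarrow> w \<in> T \<Longrightarrow> S u \<bullet> w = u \<bullet> S w"
  shows "\<exists>B \<kappa>. finite B \<and> B \<subseteq> T \<and> span B = T \<and> pairwise orthogonal B \<and>
           (\<forall>b\<in>B. norm b = 1 \<and> S b = \<kappa> b *\<^sub>R b)"
  using assms(1,3,4)
proof (induction "dim T" arbitrary: T rule: less_induct)
  case less
  note lin = \<open>linear S\<close>
  show ?case
  proof (cases "T \<subseteq> {0}")
    case True
    then have "T = {0}" using subspace_0[OF less.prems(1)] by auto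
    then show ?thesis by (intro exI[of _ "{}"]) auto
  next
    case False
    then obtain u where u: "u \<in> T" "u \<noteq> 0" by auto
    define Q where "Q x = S x \<bullet> x" for x
    have "compact (T \<inter> sphere 0 1)"
      using closed_subspace[OF less.prems(1)] by (simp add: closed_Int_compact)
    moreover have "T \<inter> sphere 0 1 \<noteq> {}"
    proof -
      have "(1 / norm u) *\<^sub>R u \<in> T \<inter> sphere 0 1"
        using u less.prems(1) by (simp add: subspace_scale)
      then show ?thesis by blast
    qed
    moreover have "continuous_on (T \<inter> sphere 0 1) Q"
      unfolding Q_def using lin by (intro continuous_intros linear_continuous_on) (simp add: linear_conv_bounded_linear)
    ultimately obtain b where b: "b \<in> T" "norm b = 1"
        and bmax: "\<And>x. x \<in> T \<Longrightarrow> norm x = 1 \<Longrightarrow> Q x \<le> Q b"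
      using continuous_attains_sup[of "T \<inter> sphere 0 1" Q] by (metis IntD1 IntD2 IntI mem_sphere_0)
    have bb: "b \<bullet> b = 1" using b by (simp add: dot_square_norm)
    have Qle: "Q x \<le> Q b * (x \<bullet> x)" if x: "x \<in> T" for x
    proof (cases "x = 0")
      case True
      then show ?thesis by (simp add: Q_def)
    next
      case False
      have "Q ((1 / norm x) *\<^sub>R x) \<le> Q b"
        using x False less.prems(1) by (intro bmax) (auto simp: subspace_scale)
      moreover have "Q ((1 / norm x) *\<^sub>R x) = Q x / (norm x)\<^sup>2"
        by (simp add: Q_def linear_scale[OF lin] power2_eq_square)
      ultimately show ?thesis using False by (simp add: divide_le_eq dot_square_norm)
    qed
    have orth: "S b \<bullet> w = 0" if w: "w \<in> T" "b \<bullet> w = 0" for w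
    proof -
      define c where "c = Q w - Q b * (w \<bullet> w)"
      have ineq: "2 * t * (S b \<bullet> w) + t\<^sup>2 * c \<le> 0" for t
      proof -
        have "b + t *\<^sub>R w \<in> T" using b w less.prems(1) by (simp add: subspace_add subspace_scale)
        note Qle[OF this]
        moreover have "Q (b + t *\<^sub>R w) = Q b + 2 * t * (S b \<bullet> w) + t\<^sup>2 * Q w"
          using less.prems(3)[OF w(1) b(1)]
          by (simp add: Q_def linear_add[OF lin] linear_scale[OF lin] inner_simps power2_eq_square
              inner_commute[of w "S b"] algebra_simps)
        moreover have "(b + t *\<^sub>R w) \<bullet> (b + t *\<^sub>R w) = 1 + t\<^sup>2 * (w \<bullet> w)"
          using bb w by (simp add: inner_simps inner_commute[of w b] power2_eq_square)
        ultimately have "Q b + 2 * t * (S b \<bullet> w) + t\<^sup>2 * Q w \<le> Q b * (1 + t\<^sup>2 * (w \<bullet> w))"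
          by (simp only:)
        then show ?thesis by (simp add: c_def algebra_simps)
      qed
      show ?thesis
      proof (rule ccontr)
        assume ne: "S b \<bullet> w \<noteq> 0"
        define p where "p = S b \<bullet> w"
        \<comment> \<open>With this \<open>t\<close> the linear term dominates the quadratic one, whatever the sign of \<open>c\<close>.\<close>
        define m where "m = \<bar>c\<bar> + 1"
        define t where "t = p / m"
        have m: "m > 0" "2 * m + c > 0" by (auto simp: m_def)
        have "2 * t * p + t\<^sup>2 * c = p\<^sup>2 * (2 * m + c) / m\<^sup>2"
          using m by (simp add: t_def field_simps power2_eq_square)
        also have "\<dots> > 0" using ne m by (intro divide_pos_pos mult_pos_pos) (auto simp: p_def)
        finally show False using ineq[of t] by (simp add: p_def)
      qed
    qed
    have SbT: "S b \<in> T" using b less.prems(2) by auto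
    have Sb: "S b = Q b *\<^sub>R b"
    proof -
      define r where "r = S b - Q b *\<^sub>R b"
      have "r \<in> T" using SbT b less.prems(1) by (simp add: r_def subspace_diff subspace_scale)
      moreover have br: "b \<bullet> r = 0"
        using bb by (simp add: r_def Q_def inner_simps inner_commute)
      ultimately have "S b \<bullet> r = 0" by (rule orth)
      then have "r \<bullet> r = 0" using br by (simp add: r_def inner_simps inner_commute)
      then show ?thesis by (simp add: r_def)
    qed
    define T' where "T' = T \<inter> {x. b \<bullet> x = 0}"
    have sT': "subspace T'"
      using less.prems(1) by (simp add: T'_def subspace_inter subspace_hyperplane)
    have "b \<notin> T'" using bb by (simp add: T'_def)
    moreover have "T' \<subseteq> T" by (simp add: T'_def)
    ultimately have "T' \<subset> T" using b by blast
    then have "dim T' < dim T"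
      using subspace_dim_equal[OF sT' less.prems(1)] by (metis linorder_not_le psubset_eq)
    moreover have "S ` T' \<subseteq> T'"
    proof
      fix z assume "z \<in> S ` T'"
      then obtain x where x: "x \<in> T" "b \<bullet> x = 0" "z = S x" by (auto simp: T'_def)
      then have "b \<bullet> z = S b \<bullet> x" using less.prems(3)[OF b(1) x(1)] by simp
      then show "z \<in> T'" using x orth less.prems(2) by (auto simp: T'_def)
    qed
    moreover have "\<And>u w. u \<in> T' \<Longrightarrow> w \<in> T' \<Longrightarrow> S u \<bullet> w = u \<bullet> S w"
      using less.prems(3) by (auto simp: T'_def)
    ultimately have "\<exists>B \<kappa>. finite B \<and> B \<subseteq> T' \<and> span B = T' \<and> pairwise orthogonal B \<and>
        (\<forall>b\<in>B. norm b = 1 \<and> S b = \<kappa> b *\<^sub>R b)"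
      by (intro less.hyps sT') auto
    then obtain B \<kappa> where B: "finite B" "B \<subseteq> T'" "span B = T'" "pairwise orthogonal B"
        and BS: "\<And>x. x \<in> B \<Longrightarrow> norm x = 1 \<and> S x = \<kappa> x *\<^sub>R x"
      by blast
    have bB: "b \<notin> B" using B \<open>b \<notin> T'\<close> by blast
    have "span (insert b B) = T"
    proof
      show "span (insert b B) \<subseteq> T"
        using B b less.prems(1) by (intro span_minimal) (auto simp: T'_def)
      show "T \<subseteq> span (insert b B)"
      proof
        fix x assume x: "x \<in> T"
        have "x - (b \<bullet> x) *\<^sub>R b \<in> T'"
          using x b bb less.prems(1) by (simp add: T'_def inner_simps subspace_diff subspace_scale)
        then show "x \<in> span (insert b B)"
          using B(3) span_breakdown_eq by blast
      qed
    qed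
    moreover have "pairwise orthogonal (insert b B)"
      using B(2,4) by (auto simp: pairwise_insert T'_def orthogonal_def inner_commute)
    ultimately show ?thesis
      using B b bB BS Sb
      by (intro exI[of _ "insert b B"] exI[of _ "\<kappa>(b := Q b)"]) (auto simp: T'_def)
  qed
qed

section \<open>Hopf's strong maximum principle\<close>

lemma second_derivative_nonpos_at_local_max:
  fixes g g' :: "real \<Rightarrow> real"
  assumes d: "d > 0" and g: "\<And>t. \<bar>t\<bar> < d \<Longrightarrow> (g has_real_derivative g' t) (at t)"
    and g': "(g' has_real_derivative c) (at 0)" and zero: "g' 0 = 0"
    and le: "\<And>t. \<bar>t\<bar> < d \<Longrightarrow> g t \<le> g 0"
  shows "c \<le> 0"
proof (rule ccontr)
  assume "\<not> c \<le> 0"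
  then obtain e where e: "e > 0" "\<And>h. 0 < h \<Longrightarrow> h < e \<Longrightarrow> g' 0 < g' (0 + h)"
    using DERIV_pos_inc_right[OF g'] by (metis not_le)
  define s where "s = min d e / 2"
  have s: "0 < s" "s < d" "s < e" using d e by (auto simp: s_def)
  obtain \<xi> where "0 < \<xi>" "\<xi> < s" "g s - g 0 = (s - 0) * g' \<xi>"
    using MVT2[of 0 s g g'] s g by auto
  moreover from this have "g' \<xi> > 0" using e(2)[of \<xi>] s zero by simp
  ultimately have "g s > g 0" using s by (simp add: algebra_simps)
  then show False using le[of s] s by simp
qed

lemma line_derivatives:
  fixes f :: "'a::real_normed_vector \<Rightarrow> real" and f' :: "'a \<Rightarrow> 'a \<Rightarrow>\<^sub>L real"
  shows "(f has_derivative blinfun_apply (f' (q + t *\<^sub>R v))) (at (q + t *\<^sub>R v)) \<Longrightarrow>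
           ((\<lambda>t. f (q + t *\<^sub>R v)) has_real_derivative blinfun_apply (f' (q + t *\<^sub>R v)) v) (at t)"
    and "(f' has_derivative f'') (at q) \<Longrightarrow>
           ((\<lambda>t. blinfun_apply (f' (q + t *\<^sub>R v)) v) has_real_derivative blinfun_apply (f'' v) v) (at 0)"
proof -
  have line: "((\<lambda>t. q + t *\<^sub>R v) has_derivative (\<lambda>h. h *\<^sub>R v)) (at t)" for t
    by (auto intro!: derivative_eq_intros)
  show "((\<lambda>t. f (q + t *\<^sub>R v)) has_real_derivative blinfun_apply (f' (q + t *\<^sub>R v)) v) (at t)"
    if "(f has_derivative blinfun_apply (f' (q + t *\<^sub>R v))) (at (q + t *\<^sub>R v))"
    using has_derivative_compose[OF line that]
    by (simp add: has_field_derivative_def blinfun.scaleR_right mult.commute[of _ "blinfun_apply _ _"])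
  show "((\<lambda>t. blinfun_apply (f' (q + t *\<^sub>R v)) v) has_real_derivative blinfun_apply (f'' v) v) (at 0)"
    if f'': "(f' has_derivative f'') (at q)"
  proof -
    have "(f' has_derivative f'') (at (q + 0 *\<^sub>R v))" using f'' by simp
    from has_derivative_compose[OF line[of 0] this]
    have "((\<lambda>t. f' (q + t *\<^sub>R v)) has_derivative (\<lambda>h. f'' (h *\<^sub>R v))) (at 0)" .
    then have "((\<lambda>t. blinfun_apply (f' (q + t *\<^sub>R v)) v) has_derivative
        (\<lambda>h. blinfun_apply (f'' (h *\<^sub>R v)) v)) (at 0)"
      by (auto intro!: derivative_eq_intros)
    then show ?thesis
      using linear_scale[OF has_derivative_linear[OF f'']]
      by (simp add: has_field_derivative_def blinfun.scaleR_left mult.commute[of _ "blinfun_apply _ _"])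
  qed
qed

lemma derivatives_at_local_max:
  fixes f :: "'a::real_normed_vector \<Rightarrow> real" and f' :: "'a \<Rightarrow> 'a \<Rightarrow>\<^sub>L real"
  assumes U: "open U" "q \<in> U" and max: "\<And>x. x \<in> U \<Longrightarrow> f x \<le> f q"
    and f: "\<And>x. x \<in> U \<Longrightarrow> (f has_derivative f' x) (at x)"
  shows "f' q = 0"
    and "(f' has_derivative f'') (at q) \<Longrightarrow> blinfun_apply (f'' v) v \<le> 0"
proof -
  obtain r where r: "r > 0" "ball q r \<subseteq> U" using U openE by blast
  have "blinfun_apply (f' q) = (\<lambda>h. 0)"
    using r max by (intro differential_zero_maxmin[OF U(2,1) f[OF U(2)]]) auto
  then show z: "f' q = 0" by (intro blinfun_eqI) simp
  show "blinfun_apply (f'' v) v \<le> 0" if f'': "(f' has_derivative f'') (at q)"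
  proof -
    define d where "d = r / (norm v + 1)"
    have nv: "norm v + 1 > 0" by (simp add: add_nonneg_pos)
    have d: "d > 0" using r nv by (simp add: d_def)
    have inU: "q + t *\<^sub>R v \<in> U" if "\<bar>t\<bar> < d" for t
    proof -
      have "\<bar>t\<bar> * norm v \<le> \<bar>t\<bar> * (norm v + 1)" by (simp add: mult_left_mono)
      also have "\<dots> < r" using that nv by (simp add: d_def field_simps)
      finally have "q + t *\<^sub>R v \<in> ball q r" by (simp add: dist_norm)
      then show ?thesis using r by blast
    qed
    show ?thesis
    proof (rule second_derivative_nonpos_at_local_max[OF d])
      show "((\<lambda>t. f (q + t *\<^sub>R v)) has_real_derivative blinfun_apply (f' (q + t *\<^sub>R v)) v) (at t)"
        if "\<bar>t\<bar> < d" for t using line_derivatives(1) f inU[OF that] by blast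
      show "((\<lambda>t. blinfun_apply (f' (q + t *\<^sub>R v)) v) has_real_derivative blinfun_apply (f'' v) v) (at 0)"
        using line_derivatives(2) f'' by blast
    qed (use z max inU in auto)
  qed
qed

text \<open>Hopf's barrier.  For large \<open>\<alpha>\<close> and away from the centre \<open>z\<close>, its second derivative in the radial
  direction, of order \<open>\<alpha>\<^sup>2\<close>, dominates the tangential ones and the gradient, which are of order \<open>\<alpha>\<close>.\<close>

definition gaussian :: "real \<Rightarrow> 'a::real_inner \<Rightarrow> 'a \<Rightarrow> real" where
  "gaussian \<alpha> z x = exp (- \<alpha> * ((x - z) \<bullet> (x - z)))"

definition gaussian_gradient :: "real \<Rightarrow> 'a::real_inner \<Rightarrow> 'a \<Rightarrow> 'a \<Rightarrow>\<^sub>L real" where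
  "gaussian_gradient \<alpha> z x = (- 2 * \<alpha> * gaussian \<alpha> z x) *\<^sub>R blinfun_inner_left (x - z)"

definition gaussian_hessian :: "real \<Rightarrow> 'a::real_inner \<Rightarrow> 'a \<Rightarrow> 'a \<Rightarrow> 'a \<Rightarrow>\<^sub>L real" where
  "gaussian_hessian \<alpha> z x h = (- 2 * \<alpha> * gaussian \<alpha> z x) *\<^sub>R blinfun_inner_left h
     + (4 * \<alpha>\<^sup>2 * gaussian \<alpha> z x * ((x - z) \<bullet> h)) *\<^sub>R blinfun_inner_left (x - z)"

lemma gaussian_derivative:
  "(gaussian \<alpha> z has_derivative gaussian_gradient \<alpha> z x) (at x)"
  unfolding gaussian_def[abs_def] gaussian_gradient_def
  by (auto intro!: derivative_eq_intros simp: fun_eq_iff gaussian_def blinfun.scaleR_left blinfun.minus_left inner_commute algebra_simps)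

lemma gaussian_gradient_derivative:
  "(gaussian_gradient \<alpha> z has_derivative gaussian_hessian \<alpha> z x) (at x)"
proof -
  have "((\<lambda>x. blinfun_inner_left (x - z)) has_derivative blinfun_inner_left) (at x)"
    using bounded_linear.has_derivative[OF bounded_linear_blinfun_inner_left, of "\<lambda>x. x - z" "\<lambda>h. h" "at x"]
    by (auto intro!: derivative_eq_intros)
  note [derivative_intros] = this
  show ?thesis
    unfolding gaussian_gradient_def[abs_def] gaussian_hessian_def[abs_def]
    by (rule derivative_eq_intros gaussian_derivative | simp)+
      (auto simp: fun_eq_iff gaussian_gradient_def blinfun.scaleR_left blinfun.minus_left inner_commute algebra_simps power2_eq_square)
qed

text \<open>Hopf's strong maximum principle for an inequality \<open>a_ij f_ij \<ge> - C \<bar>\<nabla>f\<bar>\<close>.  The matrix \<open>a\<close> is given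
  at each point as the sum of \<open>v \<otimes> v\<close> over a finite set \<open>V\<close> of vectors, which avoids coordinates and
  lets \<open>V\<close> jump from point to point, as principal frames do; \<open>\<mu>\<close> bounds it below and \<open>\<Lambda>\<close> bounds its trace.

  If \<open>f\<close> is not constant, some ball in \<open>{f < c}\<close> touches \<open>{f = c}\<close> at exactly one point \<open>p\<close> of its
  closure.  On a small ball around \<open>p\<close>, adding a small multiple of the barrier centred at the centre
  \<open>z\<close> of that ball pushes the maximum into the interior: on the part of the boundary sphere inside
  the touching ball \<open>f\<close> stays below \<open>c\<close> by a fixed amount, elsewhere the barrier is smaller than at
  \<open>p\<close>.  At the interior maximum the gradient vanishes and all second derivatives are \<open>\<le> 0\<close>, which
  contradicts the differential inequality.  The conclusion is restricted to the ball of half the radius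
  because a ball around \<open>x\<close> that reaches \<open>y\<close> must stay in the domain.\<close>

lemma strong_maximum_principle:
  fixes f :: "'a::euclidean_space \<Rightarrow> real" and f' :: "'a \<Rightarrow> 'a \<Rightarrow>\<^sub>L real"
  assumes \<mu>: "\<mu> > 0"
    and f: "\<And>x. x \<in> ball y R \<Longrightarrow> (f has_derivative f' x) (at x)"
    and f': "\<And>x. x \<in> ball y R \<Longrightarrow> (f' has_derivative f'' x) (at x)"
    and elliptic: "\<And>x. x \<in> ball y R \<Longrightarrow> \<exists>V. finite V \<and>
        (\<forall>u. \<mu> * (norm u)\<^sup>2 \<le> (\<Sum>v\<in>V. (u \<bullet> v)\<^sup>2)) \<and> (\<Sum>v\<in>V. (norm v)\<^sup>2) \<le> \<Lambda> \<and>
        - C * norm (f' x) \<le> (\<Sum>v\<in>V. blinfun_apply (f'' x v) v)"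
    and max: "\<And>x. x \<in> ball y R \<Longrightarrow> f x \<le> f y"
    and x: "x \<in> ball y (R / 2)"
  shows "f x = f y"
proof (rule ccontr)
  assume ne: "f x \<noteq> f y"
  have R: "R > 0" using x by (metis mem_ball zero_le_dist le_less_trans half_gt_zero_iff)
  define c where "c = f y"
  define K where "K = {u \<in> cball x (dist x y). f u = c}"
  have xy: "2 * dist x y < R" using x by (simp add: dist_commute)
  have sub: "cball x (dist x y) \<subseteq> ball y R"
  proof
    fix u assume u: "u \<in> cball x (dist x y)"
    have "dist y u \<le> dist y x + dist x u" by (rule dist_triangle)
    then show "u \<in> ball y R" using u xy by (simp add: dist_commute)
  qed
  have xR: "x \<in> ball y R" using xy zero_le_dist[of x y] unfolding mem_ball dist_commute[of y] by linarith
  have cont: "continuous_on (ball y R) f"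
    by (intro continuous_at_imp_continuous_on ballI has_derivative_continuous[OF f])
  have "closed K"
    unfolding K_def by (intro continuous_closed_preimage_constant continuous_on_subset[OF cont sub]) auto
  moreover have "bounded K"
    by (rule bounded_subset[OF bounded_cball]) (auto simp: K_def)
  ultimately have "compact K" by (simp add: compact_eq_bounded_closed)
  moreover have "y \<in> K" by (simp add: K_def c_def)
  ultimately have "\<exists>p\<in>K. \<forall>u\<in>K. dist x p \<le> dist x u"
    by (intro continuous_attains_inf continuous_intros) auto
  then obtain p where p: "p \<in> K" and pmin: "\<And>u. u \<in> K \<Longrightarrow> dist x p \<le> dist x u" by blast
  define d where "d = dist x p"
  have fp: "f p = c" and dle: "d \<le> dist x y" using p by (auto simp: K_def d_def)
  have "x \<noteq> p" using ne fp by (auto simp: c_def)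
  then have d: "d > 0" by (simp add: d_def)
  have inside: "f u < c" if u: "dist x u < d" for u
  proof -
    have "u \<notin> K" using pmin u by (force simp: d_def)
    moreover have "u \<in> cball x (dist x y)" using u dle by simp
    ultimately show ?thesis using max[of u] sub by (force simp: K_def c_def)
  qed
  \<comment> \<open>Halving the ball around \<open>x\<close> leaves \<open>p\<close> as the only point of contact.\<close>
  define z where "z = (1/2) *\<^sub>R (x + p)"
  define \<rho> where "\<rho> = d / 2"
  have \<rho>: "\<rho> > 0" using d by (simp add: \<rho>_def)
  have zx: "z - x = (1/2) *\<^sub>R (p - x)" and pz: "p - z = (1/2) *\<^sub>R (p - x)"
    by (simp_all add: z_def algebra_simps flip: scaleR_left.add)
  have nzx: "norm (z - x) = \<rho>" and npz: "norm (p - z) = \<rho>"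
    by (simp_all add: zx pz \<rho>_def d_def dist_norm norm_minus_commute)
  have inside': "f u < c" if u: "norm (u - z) \<le> \<rho>" "u \<noteq> p" for u
  proof -
    have "norm (u - x) < d"
    proof (rule ccontr)
      assume "\<not> norm (u - x) < d"
      then have "(norm ((u - z) + (z - x)))\<^sup>2 \<ge> d\<^sup>2" using d by (simp add: power_mono)
      moreover have "(norm ((u - z) + (z - x)))\<^sup>2 + (norm ((u - z) - (z - x)))\<^sup>2
          = 2 * (norm (u - z))\<^sup>2 + 2 * (norm (z - x))\<^sup>2"
        unfolding power2_norm_eq_inner by (simp add: inner_simps inner_commute)
      moreover have "(norm (u - z))\<^sup>2 \<le> \<rho>\<^sup>2" using u by (simp add: power_mono)
      moreover have "d\<^sup>2 = 4 * \<rho>\<^sup>2" by (simp add: \<rho>_def power2_eq_square)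
      ultimately have "(norm ((u - z) - (z - x)))\<^sup>2 \<le> 0" unfolding nzx by linarith
      then have "(u - z) - (z - x) = 0" by (simp only: power2_less_eq_zero_iff norm_eq_zero)
      then have "u - z = p - z" using zx pz by simp
      then show False using u by simp
    qed
    then show ?thesis using inside[of u] by (simp add: dist_norm norm_minus_commute)
  qed
  have "p \<in> ball y R" using p sub by (auto simp: K_def)
  then obtain r0 where r0: "r0 > 0" "ball p r0 \<subseteq> ball y R" using openE open_ball by blast
  \<comment> \<open>The first bound keeps the small ball away from \<open>z\<close>, where the barrier has its critical point.\<close>
  define r where "r = min (\<rho> / 2) (r0 / 2)"
  have r: "r > 0" "r \<le> \<rho> / 2" "cball p r \<subseteq> ball y R"
    using r0 \<rho> by (auto simp: r_def intro!: subset_trans[OF _ r0(2)])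
  define P where "P = sphere p r \<inter> cball z \<rho>"
  have "\<exists>\<delta>>0. \<forall>u\<in>P. f u \<le> c - \<delta>"
  proof (cases "P = {}")
    case False
    have "P \<subseteq> ball y R" using r(3) by (auto simp: P_def)
    then have "\<exists>m\<in>P. \<forall>u\<in>P. f u \<le> f m"
      using False by (intro continuous_attains_sup continuous_on_subset[OF cont])
        (auto simp: P_def compact_Int_closed)
    then obtain m where m: "m \<in> P" "\<forall>u\<in>P. f u \<le> f m" by blast
    have "f m < c" using m r by (intro inside') (auto simp: P_def dist_norm norm_minus_commute)
    then show ?thesis using m by (intro exI[of _ "c - f m"]) auto
  qed (auto intro: zero_less_one)
  then obtain \<delta> where \<delta>: "\<delta> > 0" and P: "\<And>u. u \<in> P \<Longrightarrow> f u \<le> c - \<delta>" by blast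
  \<comment> \<open>On the small ball the distance to \<open>z\<close> is between \<open>\<rho> / 2\<close> and \<open>2 * \<rho>\<close>; this \<open>\<alpha>\<close> makes the
    radial second derivative of the barrier win everywhere there.\<close>
  define \<alpha> where "\<alpha> = (\<bar>\<Lambda>\<bar> + \<bar>C\<bar> * (2 * \<rho>) + 1) / (2 * \<mu> * (\<rho> / 2)\<^sup>2)"
  have \<alpha>: "\<alpha> > 0" using \<mu> \<rho>
    unfolding \<alpha>_def by (intro divide_pos_pos mult_pos_pos add_nonneg_pos add_nonneg_nonneg mult_nonneg_nonneg) auto
  have \<alpha>eq: "2 * \<alpha> * \<mu> * (\<rho> / 2)\<^sup>2 = \<bar>\<Lambda>\<bar> + \<bar>C\<bar> * (2 * \<rho>) + 1"
    using \<mu> \<rho> by (simp add: \<alpha>_def)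
  define \<epsilon> where "\<epsilon> = \<delta> / 2"
  have \<epsilon>: "\<epsilon> > 0" "\<epsilon> < \<delta>" using \<delta> by (auto simp: \<epsilon>_def)
  define w where "w u = f u + \<epsilon> * gaussian \<alpha> z u" for u
  define w' where "w' u = f' u + \<epsilon> *\<^sub>R gaussian_gradient \<alpha> z u" for u
  define w'' where "w'' u h = f'' u h + \<epsilon> *\<^sub>R gaussian_hessian \<alpha> z u h" for u h
  have gnorm: "gaussian \<alpha> z u = exp (- \<alpha> * (norm (u - z))\<^sup>2)" for u
    by (simp add: gaussian_def power2_norm_eq_inner)
  have wder: "(w has_derivative w' u) (at u)" if "u \<in> ball y R" for u
    unfolding w_def[abs_def] w'_def
    using f[OF that] gaussian_derivative
    by (auto intro!: derivative_eq_intros simp: fun_eq_iff blinfun.add_left blinfun.scaleR_left)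
  have w'der: "(w' has_derivative w'' u) (at u)" if "u \<in> ball y R" for u
    unfolding w'_def[abs_def] w''_def[abs_def]
    using f'[OF that] gaussian_gradient_derivative
    by (auto intro!: derivative_eq_intros)
  have "\<exists>q\<in>cball p r. \<forall>u\<in>cball p r. w u \<le> w q"
  proof (rule continuous_attains_sup)
    show "continuous_on (cball p r) w"
      using r(3) by (intro continuous_at_imp_continuous_on ballI has_derivative_continuous[OF wder]) auto
  qed (use r in auto)
  then obtain q where q: "q \<in> cball p r" and qmax: "\<And>u. u \<in> cball p r \<Longrightarrow> w u \<le> w q" by blast
  have wp: "w p = c + \<epsilon> * exp (- \<alpha> * \<rho>\<^sup>2)" by (simp add: w_def fp gnorm npz)
  have wsphere: "w u < w p" if u: "u \<in> sphere p r" for u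
  proof (cases "u \<in> cball z \<rho>")
    case True
    then have "f u \<le> c - \<delta>" using u by (intro P) (simp add: P_def)
    moreover have "gaussian \<alpha> z u \<le> 1" using \<alpha> by (simp add: gnorm)
    then have "\<epsilon> * gaussian \<alpha> z u \<le> \<epsilon>" using \<epsilon> by simp
    moreover have "\<epsilon> * exp (- \<alpha> * \<rho>\<^sup>2) > 0" using \<epsilon> by simp
    ultimately show ?thesis using \<epsilon> unfolding wp w_def[of u] by linarith
  next
    case False
    then have "\<rho> < norm (u - z)" by (simp add: dist_norm norm_minus_commute)
    then have "\<rho>\<^sup>2 < (norm (u - z))\<^sup>2" using \<rho> by (simp add: power_strict_mono)
    then have "gaussian \<alpha> z u < exp (- \<alpha> * \<rho>\<^sup>2)" using \<alpha> by (simp add: gnorm)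
    then have "\<epsilon> * gaussian \<alpha> z u < \<epsilon> * exp (- \<alpha> * \<rho>\<^sup>2)" using \<epsilon> by simp
    moreover have "f u \<le> c" using u r(3) max by (force simp: c_def)
    ultimately show ?thesis unfolding wp w_def[of u] by linarith
  qed
  have "w p \<le> w q" using qmax r by simp
  then have qb: "q \<in> ball p r" using q wsphere[of q] by force
  have inR: "u \<in> ball y R" if "u \<in> ball p r" for u
    using that r(3) ball_subset_cball by blast
  have qR: "q \<in> ball y R" using qb by (rule inR)
  note max_w = open_ball qb qmax[OF subsetD[OF ball_subset_cball]] wder[OF inR]
  have w'0: "w' q = 0"
    by (rule derivatives_at_local_max(1)[OF max_w])
  have w''0: "blinfun_apply (w'' q v) v \<le> 0" for v
    by (rule derivatives_at_local_max(2)[OF max_w w'der[OF qR]])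
  define t where "t = norm (q - z)"
  have t: "\<rho> / 2 \<le> t" "t \<le> 2 * \<rho>"
  proof -
    have "norm (p - z) \<le> norm (p - q) + norm (q - z)" by (metis dist_norm dist_triangle)
    moreover have "norm (q - z) \<le> norm (q - p) + norm (p - z)" by (metis dist_norm dist_triangle)
    moreover have "norm (q - p) \<le> \<rho> / 2" "norm (p - q) \<le> \<rho> / 2"
      using qb r by (auto simp: dist_norm norm_minus_commute)
    ultimately show "\<rho> / 2 \<le> t" "t \<le> 2 * \<rho>" using npz \<rho> unfolding t_def by linarith+
  qed
  define G where "G = gaussian \<alpha> z q"
  have G: "G > 0" by (simp add: G_def gnorm)
  obtain V where V: "finite V" "\<And>u. \<mu> * (norm u)\<^sup>2 \<le> (\<Sum>v\<in>V. (u \<bullet> v)\<^sup>2)" "(\<Sum>v\<in>V. (norm v)\<^sup>2) \<le> \<Lambda>"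
      "- C * norm (f' q) \<le> (\<Sum>v\<in>V. blinfun_apply (f'' q v) v)"
    using elliptic[OF qR] by blast
  have "f' q = - \<epsilon> *\<^sub>R gaussian_gradient \<alpha> z q" using w'0 by (simp add: w'_def eq_neg_iff_add_eq_0)
  then have "norm (f' q) = \<epsilon> * norm (gaussian_gradient \<alpha> z q)" using \<epsilon> by simp
  also have "norm (gaussian_gradient \<alpha> z q) \<le> 2 * \<alpha> * G * t"
  proof (rule norm_blinfun_bound)
    show "norm (blinfun_apply (gaussian_gradient \<alpha> z q) h) \<le> 2 * \<alpha> * G * t * norm h" for h
    proof -
      have "norm (blinfun_apply (gaussian_gradient \<alpha> z q) h) = (2 * \<alpha> * G) * \<bar>(q - z) \<bullet> h\<bar>"
        using \<alpha> G by (simp add: gaussian_gradient_def blinfun.scaleR_left blinfun.minus_left abs_mult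
            flip: G_def inner_commute[of h])
      also have "\<dots> \<le> (2 * \<alpha> * G) * (t * norm h)"
        using Cauchy_Schwarz_ineq2[of "q - z" h] \<alpha> G unfolding t_def by (intro mult_left_mono) auto
      finally show ?thesis by (simp add: mult.assoc)
    qed
    show "0 \<le> 2 * \<alpha> * G * t"
      using \<alpha> G t \<rho> by (intro mult_nonneg_nonneg) auto
  qed
  finally have f'q: "norm (f' q) \<le> \<epsilon> * (2 * \<alpha> * G * t)" using \<epsilon> by simp
  have f''q: "blinfun_apply (f'' q v) v
      \<le> - \<epsilon> * (2 * \<alpha> * G) * (2 * \<alpha> * ((q - z) \<bullet> v)\<^sup>2 - (norm v)\<^sup>2)" for v
  proof -
    have w2: "blinfun_apply (f'' q v) v + \<epsilon> * blinfun_apply (gaussian_hessian \<alpha> z q v) v \<le> 0"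
      using w''0[of v] by (simp add: w''_def blinfun.add_left blinfun.scaleR_left)
    define i where "i = (q - z) \<bullet> v"
    have i: "v \<bullet> (q - z) = i" by (simp add: i_def inner_commute)
    have "blinfun_apply (gaussian_hessian \<alpha> z q v) v
        = - 2 * \<alpha> * G * (v \<bullet> v) + 4 * \<alpha>\<^sup>2 * G * i * i"
      by (simp only: gaussian_hessian_def blinfun.add_left blinfun.scaleR_left
          blinfun_inner_left.rep_eq i i_def[symmetric] G_def[symmetric] real_scaleR_def)
    also have "\<dots> = (2 * \<alpha> * G) * (2 * \<alpha> * i\<^sup>2 - (norm v)\<^sup>2)"
      by (simp add: dot_square_norm power2_eq_square algebra_simps)
    finally have "blinfun_apply (gaussian_hessian \<alpha> z q v) v
        = (2 * \<alpha> * G) * (2 * \<alpha> * ((q - z) \<bullet> v)\<^sup>2 - (norm v)\<^sup>2)"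
      unfolding i_def .
    with w2 show ?thesis by (simp add: mult.assoc)
  qed
  define k where "k = \<epsilon> * (2 * \<alpha> * G)"
  have k: "k > 0" using \<epsilon> \<alpha> G by (simp add: k_def)
  have "- (\<bar>C\<bar> * (k * t)) \<le> - C * norm (f' q)"
  proof -
    have "C * norm (f' q) \<le> \<bar>C\<bar> * norm (f' q)" by (simp add: mult_right_mono)
    also have "\<dots> \<le> \<bar>C\<bar> * (k * t)" using f'q by (intro mult_left_mono) (simp_all add: k_def mult.assoc)
    finally show ?thesis by simp
  qed
  also have "\<dots> \<le> (\<Sum>v\<in>V. blinfun_apply (f'' q v) v)" by (rule V)
  also have "\<dots> \<le> (\<Sum>v\<in>V. - k * (2 * \<alpha> * ((q - z) \<bullet> v)\<^sup>2 - (norm v)\<^sup>2))"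
    using f''q by (intro sum_mono) (simp add: k_def)
  also have "\<dots> = - k * (2 * \<alpha> * (\<Sum>v\<in>V. ((q - z) \<bullet> v)\<^sup>2) - (\<Sum>v\<in>V. (norm v)\<^sup>2))"
    by (simp add: sum_distrib_left sum_subtractf sum_negf right_diff_distrib)
  finally have "k * (2 * \<alpha> * (\<Sum>v\<in>V. ((q - z) \<bullet> v)\<^sup>2) - (\<Sum>v\<in>V. (norm v)\<^sup>2)) \<le> k * (\<bar>C\<bar> * t)"
    by (simp add: mult_ac)
  then have "2 * \<alpha> * (\<Sum>v\<in>V. ((q - z) \<bullet> v)\<^sup>2) - (\<Sum>v\<in>V. (norm v)\<^sup>2) \<le> \<bar>C\<bar> * t"
    using k by simp
  moreover have "2 * \<alpha> * (\<mu> * t\<^sup>2) \<le> 2 * \<alpha> * (\<Sum>v\<in>V. ((q - z) \<bullet> v)\<^sup>2)"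
    using V(2)[of "q - z"] \<alpha> by (intro mult_left_mono) (auto simp: t_def)
  moreover have "2 * \<alpha> * (\<mu> * (\<rho> / 2)\<^sup>2) \<le> 2 * \<alpha> * (\<mu> * t\<^sup>2)"
    using t \<rho> \<alpha> \<mu> by (intro mult_left_mono power_mono) auto
  moreover have "\<bar>C\<bar> * t \<le> \<bar>C\<bar> * (2 * \<rho>)"
    using t by (intro mult_left_mono) auto
  ultimately show False using \<alpha>eq V(3) by (simp add: mult.assoc)
qed

section \<open>Mean curvature in a frame of principal directions\<close>

text \<open>For the pencil \<open>L - k A\<close>: since \<open>A\<close> is injective, comparing coefficients in an eigenbasis shows that
  the eigenspace of \<open>k\<close> is spanned by the basis vectors with eigenvalue \<open>k\<close>.  This turns the sum over
  principal curvatures with multiplicities into a sum over a frame.\<close>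

lemma sum_eigenvalues_with_multiplicity:
  fixes A L :: "'a::euclidean_space \<Rightarrow> 'b::real_vector" and \<kappa> :: "'a \<Rightarrow> real"
  assumes A: "linear A" "inj A" and L: "linear L"
    and V: "finite V" "independent V" "span V = UNIV"
    and eigen: "\<And>v. v \<in> V \<Longrightarrow> L v = \<kappa> v *\<^sub>R A v"
  defines "E \<equiv> \<lambda>k. {v. L v = k *\<^sub>R A v}"
  shows "(\<Sum>k | \<exists>v\<in>E k. v \<noteq> 0. real (dim (E k)) * k) = (\<Sum>v\<in>V. \<kappa> v)"
proof -
  have E: "E k = span {v\<in>V. \<kappa> v = k}" for k
  proof
    show "span {v\<in>V. \<kappa> v = k} \<subseteq> E k"
    proof (rule span_minimal)
      show "subspace (E k)"
        using A(1) L by (auto simp: E_def subspace_def linear_add linear_scale linear_0 scaleR_add_right)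
    qed (auto simp: E_def eigen)
    show "E k \<subseteq> span {v\<in>V. \<kappa> v = k}"
    proof
      fix u assume u: "u \<in> E k"
      obtain c where c: "u = (\<Sum>v\<in>V. c v *\<^sub>R v)"
        using V(1,3) span_finite[of V] by (metis (no_types, lifting) UNIV_I imageE)
      have "A (\<Sum>v\<in>V. (c v * (\<kappa> v - k)) *\<^sub>R v) = L u - k *\<^sub>R A u"
        using A(1) L by (simp add: c linear_sum linear_scale linear_diff eigen scaleR_sum_right scaleR_diff_left
            right_diff_distrib sum_subtractf mult.commute[of k])
      then have "A (\<Sum>v\<in>V. (c v * (\<kappa> v - k)) *\<^sub>R v) = A 0"
        using u A(1) by (simp add: E_def linear_0)
      then have "(\<Sum>v\<in>V. (c v * (\<kappa> v - k)) *\<^sub>R v) = 0"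
        using A(2) by (simp add: inj_eq)
      then have cz: "c v * (\<kappa> v - k) = 0" if "v \<in> V" for v
        using independentD[OF V(2) V(1) subset_refl, of "\<lambda>v. c v * (\<kappa> v - k)" v] that by blast
      have "c v *\<^sub>R v \<in> span {v\<in>V. \<kappa> v = k}" if "v \<in> V" for v
        using cz[OF that] that by (cases "\<kappa> v = k") (auto intro: span_scale span_base span_zero)
      then show "u \<in> span {v\<in>V. \<kappa> v = k}"
        unfolding c by (rule span_sum)
    qed
  qed
  have dim: "dim (E k) = card {v\<in>V. \<kappa> v = k}" for k
    unfolding E dim_span by (rule dim_eq_card_independent) (rule independent_mono[OF V(2)], auto)
  have "{k. \<exists>v\<in>E k. v \<noteq> 0} = \<kappa> ` V"
  proof (intro subset_antisym subsetI)
    fix k assume "k \<in> {k. \<exists>v\<in>E k. v \<noteq> 0}"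
    then have "\<not> span {v\<in>V. \<kappa> v = k} \<subseteq> {0}" unfolding E by auto
    then have "{v\<in>V. \<kappa> v = k} \<noteq> {}" by (metis span_empty subset_refl)
    then show "k \<in> \<kappa> ` V" by auto
  next
    fix k assume "k \<in> \<kappa> ` V"
    then obtain v where v: "v \<in> V" "k = \<kappa> v" by auto
    moreover have "v \<noteq> 0" using v V(2) dependent_zero by blast
    moreover have "v \<in> E k" using v by (simp add: E_def eigen)
    ultimately show "k \<in> {k. \<exists>v\<in>E k. v \<noteq> 0}" by blast
  qed
  then have "(\<Sum>k | \<exists>v\<in>E k. v \<noteq> 0. real (dim (E k)) * k)
      = (\<Sum>k\<in>\<kappa> ` V. \<Sum>v | v \<in> V \<and> \<kappa> v = k. \<kappa> v)"
    by (simp add: dim)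
  also have "\<dots> = (\<Sum>v\<in>V. \<kappa> v)" using V(1) by (rule sum.image_gen[symmetric])
  finally show ?thesis .
qed

text \<open>A local parametrization with its unit normal and the derivatives of both.  Working with a fixed
  choice of derivatives lets all estimates be made in the parameter domain.\<close>

locale hypersurface_patch =
  fixes \<Omega> :: "(real ^ 'n::finite) set"
    and X N :: "real ^ 'n \<Rightarrow> real ^ 'm::finite"
    and X' N' :: "real ^ 'n \<Rightarrow> (real ^ 'n) \<Rightarrow>\<^sub>L (real ^ 'm)"
    and X'' :: "real ^ 'n \<Rightarrow> (real ^ 'n) \<Rightarrow>\<^sub>L (real ^ 'n) \<Rightarrow>\<^sub>L (real ^ 'm)"
  assumes codimension_one: "CARD('m) = CARD('n) + 1"
    and open_domain: "open \<Omega>"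
    and X: "\<And>y. y \<in> \<Omega> \<Longrightarrow> (X has_derivative X' y) (at y)"
    and X': "\<And>y. y \<in> \<Omega> \<Longrightarrow> (X' has_derivative X'' y) (at y)"
    and X''_continuous: "continuous_on \<Omega> X''"
    and immersion: "\<And>y. y \<in> \<Omega> \<Longrightarrow> inj (X' y)"
    and N: "\<And>y. y \<in> \<Omega> \<Longrightarrow> (N has_derivative N' y) (at y)"
    and unit_normal: "\<And>y. y \<in> \<Omega> \<Longrightarrow> norm (N y) = 1"
    and normal: "\<And>y v. y \<in> \<Omega> \<Longrightarrow> N y \<bullet> X' y v = 0"
begin

lemma tangent_iff_orthogonal_normal:
  assumes "y \<in> \<Omega>"
  shows "w \<in> range (X' y) \<longleftrightarrow> N y \<bullet> w = 0"
proof -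
  have lin: "linear (X' y)" by (intro bounded_linear.linear blinfun.bounded_linear_right)
  have "N y \<noteq> 0" using unit_normal[OF assms] by auto
  then have "dim {x. N y \<bullet> x = 0} = CARD('n)"
    using codimension_one by (simp add: dim_hyperplane)
  moreover have "dim (range (X' y)) = CARD('n)"
    using dim_image_eq[OF lin, of UNIV] immersion[OF assms] by simp
  ultimately have "range (X' y) = {x. N y \<bullet> x = 0}"
    using normal[OF assms] lin
    by (intro subspace_dim_equal subspace_hyperplane linear_subspace_image subspace_UNIV) auto
  then show ?thesis by auto
qed

lemma second_derivative_commute:
  assumes "y \<in> \<Omega>"
  shows "X'' y u v \<bullet> e = X'' y v u \<bullet> e"
proof -
  let ?P = "blinfun_inner_left e"
  have "blinfun_apply (?P o\<^sub>L X'' y u) v = blinfun_apply (?P o\<^sub>L X'' y v) u"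
  proof (rule second_derivative_symmetric[OF open_domain assms, of "\<lambda>x. X x \<bullet> e" "\<lambda>x. ?P o\<^sub>L X' x"])
    show "((\<lambda>x. X x \<bullet> e) has_derivative blinfun_apply (?P o\<^sub>L X' x)) (at x)" if "x \<in> \<Omega>" for x
      using X[OF that] by (auto intro!: derivative_eq_intros)
    show "((\<lambda>x. ?P o\<^sub>L X' x) has_derivative (\<lambda>u. ?P o\<^sub>L X'' y u)) (at y)"
      using bounded_linear.has_derivative[OF bounded_bilinear.bounded_linear_right[OF bounded_bilinear_blinfun_compose] X'[OF assms]] .
  qed
  then show ?thesis by simp
qed

text \<open>Both identities come from differentiating a constant: \<open>N \<bullet> dX w = 0\<close> and \<open>N \<bullet> N = 1\<close>.  The first
  expresses the shape operator through \<open>N \<bullet> X''\<close>, whence its symmetry; the second says that it maps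
  into the tangent space.\<close>

lemma second_fundamental_form:
  assumes "y \<in> \<Omega>"
  shows "N' y v \<bullet> X' y w = - (N y \<bullet> X'' y v w)" and "N' y v \<bullet> N y = 0"
proof -
  have "((\<lambda>z. N z \<bullet> X' z w) has_derivative (\<lambda>v. N y \<bullet> X'' y v w + N' y v \<bullet> X' y w)) (at y)"
    using N[OF assms] X'[OF assms] by (auto intro!: derivative_eq_intros)
  moreover have "((\<lambda>z. N z \<bullet> X' z w) has_derivative (\<lambda>v. 0)) (at y)"
    by (rule has_derivative_transform_within_open[OF _ open_domain assms, of "\<lambda>_. 0"]) (auto simp: normal)
  ultimately have "(\<lambda>v. N y \<bullet> X'' y v w + N' y v \<bullet> X' y w) = (\<lambda>v. 0)"
    by (rule has_derivative_unique)
  then have "N y \<bullet> X'' y v w + N' y v \<bullet> X' y w = 0" by meson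
  then show "N' y v \<bullet> X' y w = - (N y \<bullet> X'' y v w)" by simp
  have "((\<lambda>z. N z \<bullet> N z) has_derivative (\<lambda>v. N y \<bullet> N' y v + N' y v \<bullet> N y)) (at y)"
    using N[OF assms] by (auto intro!: derivative_eq_intros)
  moreover have "((\<lambda>z. N z \<bullet> N z) has_derivative (\<lambda>v. 0)) (at y)"
    by (rule has_derivative_transform_within_open[OF _ open_domain assms, of "\<lambda>_. 1"])
      (auto simp: unit_normal dot_square_norm)
  ultimately have "(\<lambda>v. N y \<bullet> N' y v + N' y v \<bullet> N y) = (\<lambda>v. 0)"
    by (rule has_derivative_unique)
  then have "N y \<bullet> N' y v + N' y v \<bullet> N y = 0" by meson
  then show "N' y v \<bullet> N y = 0" by (simp add: inner_commute)
qed

text \<open>Principal directions, orthonormal for the induced metric.  The spectral theorem is applied in the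
  tangent space \<open>T\<close>, a subspace of the Euclidean ambient space, where the induced inner product is the
  ambient one; a linear left inverse \<open>g\<close> of \<open>dX\<close> carries the eigenvectors back to the parameter
  domain.  In such a frame the trace of the second fundamental form is \<open>n\<close> times the mean curvature.\<close>

lemma principal_frame:
  assumes y: "y \<in> \<Omega>"
  obtains V where "finite V" "card V = CARD('n)" "independent V" "span V = UNIV"
    "\<And>v w. v \<in> V \<Longrightarrow> w \<in> V \<Longrightarrow> X' y v \<bullet> X' y w = (if v = w then 1 else 0)"
    "(\<Sum>v\<in>V. N y \<bullet> X'' y v v) = real CARD('n) * mean_curvature X N y"
proof -
  have lin: "linear (X' y)" "linear (\<lambda>v. - blinfun_apply (N' y) v)"
    by (intro linear_compose_neg bounded_linear.linear blinfun.bounded_linear_right)+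
  obtain g where g: "linear g" "g \<circ> X' y = id"
    using linear_injective_left_inverse[OF lin(1) immersion[OF y]] by blast
  have g': "g (X' y v) = v" for v using g(2) by (metis comp_apply id_apply)
  define T where "T = range (X' y)"
  define S where "S w = - blinfun_apply (N' y) (g w)" for w
  have "\<exists>B \<kappa>. finite B \<and> B \<subseteq> T \<and> span B = T \<and> pairwise orthogonal B \<and>
           (\<forall>b\<in>B. norm b = 1 \<and> S b = \<kappa> b *\<^sub>R b)"
  proof (rule spectral_theorem)
    show "subspace T" unfolding T_def by (intro linear_subspace_image lin subspace_UNIV)
    show "linear S" using linear_compose[OF g(1) lin(2)] by (simp add: S_def[abs_def] comp_def)
    show "S ` T \<subseteq> T"
      using tangent_iff_orthogonal_normal[OF y] second_fundamental_form(2)[OF y]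
      by (auto simp: T_def S_def inner_commute)
    show "S u \<bullet> w = u \<bullet> S w" if uw: "u \<in> T" "w \<in> T" for u w
    proof -
      obtain a b where "u = X' y a" "w = X' y b" using uw by (auto simp: T_def)
      then show ?thesis
        using second_fundamental_form(1)[OF y, of a b] second_fundamental_form(1)[OF y, of b a]
          second_derivative_commute[OF y, of a b "N y"]
        by (simp add: S_def g' inner_commute)
    qed
  qed
  then obtain B \<kappa> where B: "finite B" "B \<subseteq> T" "span B = T" "pairwise orthogonal B"
      and eig: "\<And>b. b \<in> B \<Longrightarrow> norm b = 1" "\<And>b. b \<in> B \<Longrightarrow> S b = \<kappa> b *\<^sub>R b" by blast
  have gT: "X' y (g b) = b" if "b \<in> T" for b using that g' by (auto simp: T_def)
  define V where "V = g ` B"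
  have XV: "X' y v \<in> B" if "v \<in> V" for v using that gT B(2) by (auto simp: V_def)
  have orth: "X' y v \<bullet> X' y w = (if v = w then 1 else 0)" if "v \<in> V" "w \<in> V" for v w
  proof (cases "v = w")
    case True
    then show ?thesis using eig(1)[OF XV[OF that(1)]] by (simp add: dot_square_norm)
  next
    case False
    then have "X' y v \<noteq> X' y w" using g' by metis
    then show ?thesis using B(4) XV that False by (simp add: pairwise_def orthogonal_def)
  qed
  have fin: "finite V" using B(1) by (simp add: V_def)
  have "0 \<notin> B" using eig(1) by force
  then have "independent B" using B(4) by (simp add: pairwise_orthogonal_independent)
  then have ind: "independent V"
    unfolding V_def
  proof (rule linear_independent_injective_image[OF g(1)])
    show "inj_on g (span B)" unfolding B(3) by (rule inj_on_inverseI[of _ "X' y"]) (rule gT)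
  qed
  have "span V = g ` T" unfolding V_def linear_span_image[OF g(1)] B(3) ..
  also have "\<dots> = UNIV" by (auto simp: T_def image_image g')
  finally have sp: "span V = UNIV" .
  have "card V = dim (UNIV :: (real ^ 'n) set)"
    using dim_eq_card[of V UNIV] ind sp by simp
  then have card: "card V = CARD('n)" by simp
  define k where "k v = N y \<bullet> X'' y v v" for v
  have eigV: "- blinfun_apply (N' y) v = k v *\<^sub>R X' y v" if v: "v \<in> V" for v
  proof -
    let ?b = "X' y v"
    have *: "- blinfun_apply (N' y) v = \<kappa> ?b *\<^sub>R ?b"
      using eig(2)[OF XV[OF v]] by (simp add: S_def g')
    then have "\<kappa> ?b = - blinfun_apply (N' y) v \<bullet> ?b"
      using orth[OF v v] by simp
    then have "\<kappa> ?b = k v" using second_fundamental_form(1)[OF y, of v v] by (simp add: k_def)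
    with * show ?thesis by simp
  qed
  have ps: "principal_space X N y c = {v. - blinfun_apply (N' y) v = c *\<^sub>R X' y v}" for c
    by (simp add: principal_space_def frechet_derivative_at[OF X[OF y], symmetric]
        frechet_derivative_at[OF N[OF y], symmetric])
  have "mean_curvature X N y = (\<Sum>v\<in>V. k v) / real CARD('n)"
    unfolding mean_curvature_def principal_curvatures_def ps
    by (subst sum_eigenvalues_with_multiplicity[OF lin(1) immersion[OF y] lin(2) fin ind sp eigV])
      (assumption | rule refl)+
  then have "(\<Sum>v\<in>V. N y \<bullet> X'' y v v) = real CARD('n) * mean_curvature X N y"
    by (simp add: k_def)
  with fin card ind sp orth show thesis by (rule that)
qed

end

section \<open>Height functions on a hypersurface\<close>

text \<open>The ellipticity bound for a frame that is orthonormal for the metric induced by \<open>A\<close>.  If \<open>c\<close> are the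
  coefficients of \<open>u\<close>, then \<open>\<bar>A u\<bar>\<^sup>2\<close> is the sum of the \<open>c v\<^sup>2\<close>, and \<open>\<bar>u\<bar>\<^sup>2\<close> is the sum of the
  \<open>c v (u \<bullet> v)\<close>; Cauchy-Schwarz does the rest.\<close>

lemma norm_le_of_orthonormal_images:
  fixes A :: "'a::euclidean_space \<Rightarrow> 'b::real_inner"
  assumes A: "linear A" "\<And>v. norm (A v) \<le> K * norm v"
    and V: "finite V" "span V = UNIV"
    and orth: "\<And>v w. v \<in> V \<Longrightarrow> w \<in> V \<Longrightarrow> A v \<bullet> A w = (if v = w then 1 else 0)"
  shows "(norm u)\<^sup>2 \<le> K\<^sup>2 * (\<Sum>v\<in>V. (u \<bullet> v)\<^sup>2)"
proof (cases "u = 0")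
  case False
  obtain c where c: "u = (\<Sum>v\<in>V. c v *\<^sub>R v)"
    using V span_finite[of V] by (metis (no_types, lifting) UNIV_I imageE)
  have "A u \<bullet> A u = (\<Sum>v\<in>V. \<Sum>w\<in>V. c v * (c w * (A w \<bullet> A v)))"
    using A(1) by (simp add: c linear_sum linear_scale inner_sum_left inner_sum_right sum_distrib_left)
  also have "\<dots> = (\<Sum>v\<in>V. \<Sum>w\<in>V. if v = w then c v * c w else 0)"
    by (intro sum.cong refl) (auto simp: orth)
  also have "\<dots> = (\<Sum>v\<in>V. (c v)\<^sup>2)"
    using V(1) by (simp add: power2_eq_square)
  finally have "(\<Sum>v\<in>V. (c v)\<^sup>2) = (norm (A u))\<^sup>2" by (simp add: power2_norm_eq_inner)
  also have "\<dots> \<le> K\<^sup>2 * (norm u)\<^sup>2"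
    using A(2)[of u] power_mono[of "norm (A u)" "K * norm u" 2] by (simp add: power_mult_distrib)
  finally have cK: "(\<Sum>v\<in>V. (c v)\<^sup>2) \<le> K\<^sup>2 * (norm u)\<^sup>2" .
  have "(norm u)\<^sup>2 = u \<bullet> (\<Sum>v\<in>V. c v *\<^sub>R v)"
    by (simp add: power2_norm_eq_inner flip: c)
  also have "\<dots> = (\<Sum>v\<in>V. c v * (u \<bullet> v))" by (simp add: inner_sum_right)
  finally have "((norm u)\<^sup>2)\<^sup>2 \<le> (\<Sum>v\<in>V. (c v)\<^sup>2) * (\<Sum>v\<in>V. (u \<bullet> v)\<^sup>2)"
    using Cauchy_Schwarz_ineq_sum[of c "\<lambda>v. u \<bullet> v" V] by simp
  also have "\<dots> \<le> (K\<^sup>2 * (norm u)\<^sup>2) * (\<Sum>v\<in>V. (u \<bullet> v)\<^sup>2)"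
    using cK by (intro mult_right_mono sum_nonneg) auto
  finally have "(norm u)\<^sup>2 * (norm u)\<^sup>2 \<le> (norm u)\<^sup>2 * (K\<^sup>2 * (\<Sum>v\<in>V. (u \<bullet> v)\<^sup>2))"
    by (simp add: power2_eq_square[of "(norm u)\<^sup>2"] mult_ac)
  then show ?thesis by (rule mult_left_le_imp_le) (use False in simp)
qed (simp add: sum_nonneg)

context hypersurface_patch
begin

definition height_gradient :: "real ^ 'm \<Rightarrow> real ^ 'n \<Rightarrow> (real ^ 'n) \<Rightarrow>\<^sub>L real" where
  "height_gradient e y = blinfun_inner_left e o\<^sub>L X' y"

definition height_hessian :: "real ^ 'm \<Rightarrow> real ^ 'n \<Rightarrow> real ^ 'n \<Rightarrow> (real ^ 'n) \<Rightarrow>\<^sub>L real" where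
  "height_hessian e y h = blinfun_inner_left e o\<^sub>L X'' y h"

lemma height_derivatives:
  assumes "y \<in> \<Omega>"
  shows "((\<lambda>z. X z \<bullet> e) has_derivative height_gradient e y) (at y)"
    and "(height_gradient e has_derivative height_hessian e y) (at y)"
proof -
  show "((\<lambda>z. X z \<bullet> e) has_derivative height_gradient e y) (at y)"
    using X[OF assms] by (auto intro!: derivative_eq_intros simp: height_gradient_def)
  show "(height_gradient e has_derivative height_hessian e y) (at y)"
    unfolding height_gradient_def[abs_def] height_hessian_def[abs_def]
    by (rule bounded_linear.has_derivative[OF bounded_bilinear.bounded_linear_right[OF
        bounded_bilinear_blinfun_compose] X'[OF assms]])
qed

text \<open>At a critical point of the height the direction \<open>e\<close> is orthogonal to the tangent space.\<close>

lemma normal_at_height_max: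
  assumes U: "open U" "y \<in> U" "U \<subseteq> \<Omega>" and max: "\<And>z. z \<in> U \<Longrightarrow> X z \<bullet> e \<le> X y \<bullet> e"
    and e: "norm e = 1"
  shows "N y = e \<or> N y = - e"
proof -
  have y: "y \<in> \<Omega>" using U by blast
  have "height_gradient e y = 0"
    using U max height_derivatives(1) by (intro derivatives_at_local_max(1)[of U y "\<lambda>z. X z \<bullet> e"]) auto
  then have tan: "X' y v \<bullet> e = 0" for v
    using blinfun_apply_blinfun_compose[of "blinfun_inner_left e" "X' y" v] by (simp add: height_gradient_def)
  define a where "a = N y \<bullet> e"
  have "N y \<bullet> (e - a *\<^sub>R N y) = 0"
    using unit_normal[OF y] by (simp add: a_def inner_simps dot_square_norm)
  then obtain w where w: "e - a *\<^sub>R N y = X' y w"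
    using tangent_iff_orthogonal_normal[OF y] by (metis imageE)
  have "X' y w \<bullet> X' y w = X' y w \<bullet> e - a * (X' y w \<bullet> N y)"
    by (simp flip: w add: inner_simps)
  also have "\<dots> = 0" using tan normal[OF y, of w] by (simp add: inner_commute)
  finally have eN: "e = a *\<^sub>R N y" using w by simp
  then have "\<bar>a\<bar> = 1" using e unit_normal[OF y] by (metis norm_scaleR mult.right_neutral)
  then show ?thesis using eN by (auto simp: abs_if split: if_splits)
qed

text \<open>With \<open>e = s N\<close> the Hessian of the height at \<open>y\<close> is \<open>s\<close> times the second fundamental form, and it is
  negative semidefinite at a maximum.\<close>

lemma mean_curvature_sign_at_height_max:
  assumes U: "open U" "y \<in> U" "U \<subseteq> \<Omega>" and max: "\<And>z. z \<in> U \<Longrightarrow> X z \<bullet> (s *\<^sub>R N y) \<le> X y \<bullet> (s *\<^sub>R N y)"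
  shows "s * mean_curvature X N y \<le> 0"
proof -
  have y: "y \<in> \<Omega>" using U by blast
  obtain V where V: "(\<Sum>v\<in>V. N y \<bullet> X'' y v v) = real CARD('n) * mean_curvature X N y"
    by (rule principal_frame[OF y]) (rule that)
  have "s * (N y \<bullet> X'' y v v) \<le> 0" for v
  proof -
    have "blinfun_apply (height_hessian (s *\<^sub>R N y) y v) v \<le> 0"
      using derivatives_at_local_max(2)[OF U(1,2) max height_derivatives(1) height_derivatives(2)[OF y]] U(3)
      by blast
    then show ?thesis by (simp add: height_hessian_def inner_commute)
  qed
  then have "(\<Sum>v\<in>V. s * (N y \<bullet> X'' y v v)) \<le> 0" by (intro sum_nonpos)
  then have "s * (real CARD('n) * mean_curvature X N y) \<le> 0" by (simp add: V flip: sum_distrib_left)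
  then have "real CARD('n) * (s * mean_curvature X N y) \<le> 0" by (simp add: mult_ac)
  then show ?thesis by (simp add: mult_le_0_iff)
qed

text \<open>The tangential part of \<open>e\<close> is the gradient of the height for the induced metric; the bound compares
  its length with that of the gradient in the parameter domain.\<close>

lemma tangential_part_bound:
  assumes y: "y \<in> \<Omega>" and b: "b > 0" "\<And>v. b * norm v \<le> norm (X' y v)"
  shows "norm (e - (N y \<bullet> e) *\<^sub>R N y) \<le> norm (height_gradient e y) / b"
proof -
  define T where "T = e - (N y \<bullet> e) *\<^sub>R N y"
  have NN: "N y \<bullet> N y = 1" using unit_normal[OF y] by (simp add: dot_square_norm)
  then have NT: "N y \<bullet> T = 0" by (simp add: T_def inner_simps)
  then obtain w where w: "T = X' y w"
    using tangent_iff_orthogonal_normal[OF y] by (metis imageE)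
  have "(norm T)\<^sup>2 = T \<bullet> T + (N y \<bullet> e) * (N y \<bullet> T)" by (simp add: NT power2_norm_eq_inner)
  also have "\<dots> = T \<bullet> e" by (simp add: T_def inner_simps inner_commute NN algebra_simps)
  also have "\<dots> = height_gradient e y w" by (simp add: height_gradient_def w)
  also have "\<dots> \<le> norm (height_gradient e y) * norm w"
    using norm_blinfun[of "height_gradient e y" w] by simp
  also have "\<dots> \<le> norm (height_gradient e y) * (norm T / b)"
    using b(2)[of w] b(1) by (intro mult_left_mono) (auto simp: w field_simps)
  finally have "norm T * norm T \<le> (norm (height_gradient e y) / b) * norm T"
    by (simp add: power2_eq_square)
  moreover have "0 \<le> norm (height_gradient e y) / b" using b by simp
  ultimately show ?thesis unfolding T_def[symmetric]
    by (metis mult_right_le_imp_le norm_ge_zero order_le_less)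
qed

text \<open>With \<open>a = s (N \<bullet> e)\<close> the squared left side is \<open>2 (1 - a)\<close> and the squared norm of the tangential part
  is \<open>(1 - a) (1 + a)\<close>.  As \<open>N\<close> is near \<open>s e\<close> rather than \<open>- s e\<close>, \<open>a\<close> is not negative.\<close>

lemma normal_deviation_bound:
  assumes y: "y \<in> \<Omega>" and e: "norm e = 1" and s: "\<bar>s\<bar> = 1" and near: "norm (N y - s *\<^sub>R e) \<le> 1"
  shows "norm (N y - s *\<^sub>R e) \<le> 2 * norm (e - (N y \<bullet> e) *\<^sub>R N y)"
proof -
  define a where "a = s * (N y \<bullet> e)"
  have ss: "s * s = 1" using s by (metis abs_mult_self_eq mult_1)
  have NN: "N y \<bullet> N y = 1" and ee: "e \<bullet> e = 1"
    using unit_normal[OF y] e by (simp_all add: dot_square_norm)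
  have 1: "(norm (N y - s *\<^sub>R e))\<^sup>2 = 2 - 2 * a"
    unfolding power2_norm_eq_inner
    by (simp add: inner_simps NN ee ss a_def inner_commute mult.assoc[symmetric])
  have "(norm (e - (N y \<bullet> e) *\<^sub>R N y))\<^sup>2 = 1 - (N y \<bullet> e)\<^sup>2"
    unfolding power2_norm_eq_inner
    by (simp add: inner_simps NN ee inner_commute power2_eq_square)
  also have "\<dots> = 1 - a\<^sup>2" using ss by (simp add: a_def power_mult_distrib power2_eq_square[of s])
  finally have 2: "(norm (e - (N y \<bullet> e) *\<^sub>R N y))\<^sup>2 = (1 - a) * (1 + a)"
    by (simp add: power2_eq_square algebra_simps)
  have "(norm (N y - s *\<^sub>R e))\<^sup>2 \<le> 1" using near by (simp add: power_le_one)
  then have a: "a \<ge> 0" using 1 by simp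
  have "0 \<le> (norm (N y - s *\<^sub>R e))\<^sup>2" by simp
  then have "a \<le> 1" using 1 by simp
  have "(1 - a) * 1 \<le> (1 - a) * (1 + a)" using a \<open>a \<le> 1\<close> by (intro mult_left_mono) auto
  moreover have "(norm (N y - s *\<^sub>R e))\<^sup>2 \<le> 4 * (1 - a)" using 1 \<open>a \<le> 1\<close> by simp
  ultimately have "(norm (N y - s *\<^sub>R e))\<^sup>2 \<le> (2 * norm (e - (N y \<bullet> e) *\<^sub>R N y))\<^sup>2"
    unfolding power_mult_distrib 2 by simp
  then show ?thesis by (rule power2_le_imp_le) simp
qed

end

section \<open>Comparison with the tangent hyperplane\<close>

context hypersurface_patch
begin

text \<open>The comparison with the tangent hyperplane.  The curvature hypothesis is what a prescribed mean
  curvature function that vanishes at \<open>N y0\<close> and is Lipschitz there provides.  Decompose \<open>e = a N + T\<close>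
  with \<open>T\<close> tangential.  Summed over a principal frame, the Hessian of the height splits into \<open>a\<close> times
  \<open>n\<close> times the mean curvature and a term bounded by \<open>\<bar>T\<bar>\<close>; by the two preceding lemmas both are
  bounded by the gradient of the height, so the strong maximum principle applies.\<close>

lemma height_constant_near_max:
  assumes U: "open U" "y0 \<in> U" "U \<subseteq> \<Omega>"
    and max: "\<And>y. y \<in> U \<Longrightarrow> X y \<bullet> e \<le> X y0 \<bullet> e"
    and e: "norm e = 1" and s: "\<bar>s\<bar> = 1" and N0: "N y0 = s *\<^sub>R e"
    and curvature: "\<And>y. y \<in> U \<Longrightarrow> \<bar>mean_curvature X N y\<bar> \<le> L * norm (N y - s *\<^sub>R e)"
  shows "\<exists>R>0. ball y0 R \<subseteq> U \<and> (\<forall>y\<in>ball y0 R. X y \<bullet> e = X y0 \<bullet> e)"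
proof -
  have y0: "y0 \<in> \<Omega>" using U by blast
  obtain b0 where b0: "b0 > 0" "\<And>v. b0 * norm v \<le> norm (X' y0 v)"
    using linear_inj_bounded_below_pos[OF bounded_linear.linear[OF blinfun.bounded_linear_right] immersion[OF y0]] by blast
  \<comment> \<open>\<open>b\<close> and \<open>K\<close> will bound \<open>dX\<close> below and above near \<open>y0\<close>, and \<open>M\<close> will bound \<open>X''\<close>.\<close>
  define b where "b = b0 / 2"
  define K where "K = norm (X' y0) + b"
  define M where "M = norm (X'' y0) + 1"
  have b: "b > 0" and K: "K > 0" and M: "M > 0"
    using b0 by (auto simp: b_def K_def M_def add_nonneg_pos)
  have near: "\<forall>\<^sub>F y in nhds y0. dist (g y) (g y0) < \<epsilon>"
    if "isCont g y0" "\<epsilon> > 0" for g :: "real ^ 'n \<Rightarrow> 'z::metric_space" and \<epsilon>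
    using that by (simp add: isCont_def tendsto_at_iff_tendsto_nhds tendstoD)
  have "\<forall>\<^sub>F y in nhds y0. y \<in> U \<and> dist (X' y) (X' y0) < b \<and> dist (X'' y) (X'' y0) < 1 \<and> dist (N y) (N y0) < 1"
  proof (intro eventually_conj near)
    show "\<forall>\<^sub>F y in nhds y0. y \<in> U" using U by (simp add: eventually_nhds_in_open)
    show "isCont X' y0" by (rule has_derivative_continuous[OF X'[OF y0]])
    show "isCont N y0" by (rule has_derivative_continuous[OF N[OF y0]])
    show "isCont X'' y0"
      using X''_continuous y0 open_domain by (simp add: continuous_on_eq_continuous_at)
  qed (use b in auto)
  then obtain R where R: "R > 0" and nearR: "\<And>y. dist y y0 < R \<Longrightarrow>
      y \<in> U \<and> dist (X' y) (X' y0) < b \<and> dist (X'' y) (X'' y0) < 1 \<and> dist (N y) (N y0) < 1"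
    unfolding eventually_nhds_metric by blast
  have nearU: "y \<in> U" and near\<Omega>: "y \<in> \<Omega>" and near': "dist (X' y) (X' y0) < b"
    and near'': "dist (X'' y) (X'' y0) < 1" and nearN: "norm (N y - s *\<^sub>R e) \<le> 1"
    if "y \<in> ball y0 R" for y
  proof -
    have "dist y y0 < R" using that by (simp add: dist_commute)
    note * = nearR[OF this]
    show "y \<in> U" "dist (X' y) (X' y0) < b" "dist (X'' y) (X'' y0) < 1" using * by blast+
    then show "y \<in> \<Omega>" using U(3) by blast
    show "norm (N y - s *\<^sub>R e) \<le> 1" using * by (simp add: N0 dist_norm)
  qed
  define n where "n = real CARD('n)"
  have n: "n > 0" by (simp add: n_def)
  define C where "C = (2 * n * \<bar>L\<bar> + M * (n / b\<^sup>2)) / b"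
  have "X y \<bullet> e = X y0 \<bullet> e" if "y \<in> ball y0 (R / 2)" for y
  proof (rule strong_maximum_principle[where \<mu> = "1 / K\<^sup>2" and f = "\<lambda>z. X z \<bullet> e" and R = R
        and f' = "height_gradient e" and f'' = "height_hessian e" and \<Lambda> = "n / b\<^sup>2" and C = C])
    fix y assume y: "y \<in> ball y0 R"
    note y\<Omega> = near\<Omega>[OF y]
    have lower: "b * norm v \<le> norm (X' y v)" for v
    proof -
      have "norm (X' y0 v) = norm (X' y v - blinfun_apply (X' y - X' y0) v)"
        by (simp add: blinfun.diff_left)
      also have "\<dots> \<le> norm (X' y v) + norm (blinfun_apply (X' y - X' y0) v)"
        by (rule norm_triangle_ineq4)
      also have "norm (blinfun_apply (X' y - X' y0) v) \<le> norm (X' y - X' y0) * norm v"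
        by (rule norm_blinfun)
      also have "\<dots> \<le> b * norm v"
        using near'[OF y] by (intro mult_right_mono) (auto simp: dist_norm)
      finally show ?thesis using b0(2)[of v] by (simp add: b_def)
    qed
    have "norm (X' y) \<le> K"
      using near'[OF y] norm_triangle_sub[of "X' y" "X' y0"] by (simp add: K_def dist_norm)
    then have upper: "norm (X' y v) \<le> K * norm v" for v
      using norm_blinfun[of "X' y" v] by (meson mult_right_mono norm_ge_zero order_trans)
    have "norm (X'' y) \<le> M"
      using near''[OF y] norm_triangle_sub[of "X'' y" "X'' y0"] by (simp add: M_def dist_norm)
    then have X''_bound: "norm (X'' y v v) \<le> M * (norm v)\<^sup>2" for v
    proof -
      have "norm (X'' y v v) \<le> norm (X'' y v) * norm v" by (rule norm_blinfun)
      also have "\<dots> \<le> (norm (X'' y) * norm v) * norm v" by (intro mult_right_mono norm_blinfun) auto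
      also have "\<dots> \<le> (M * norm v) * norm v"
        using \<open>norm (X'' y) \<le> M\<close> by (intro mult_right_mono) auto
      finally show ?thesis by (simp add: power2_eq_square mult.assoc)
    qed
    obtain V where V: "finite V" "card V = CARD('n)" "independent V" "span V = UNIV"
        and orth: "\<And>v w. v \<in> V \<Longrightarrow> w \<in> V \<Longrightarrow> X' y v \<bullet> X' y w = (if v = w then 1 else 0)"
        and trace: "(\<Sum>v\<in>V. N y \<bullet> X'' y v v) = real CARD('n) * mean_curvature X N y"
      by (rule principal_frame[OF y\<Omega>]) (rule that)
    have "(1 / K\<^sup>2) * (norm u)\<^sup>2 \<le> (\<Sum>v\<in>V. (u \<bullet> v)\<^sup>2)" for u
      using norm_le_of_orthonormal_images[OF bounded_linear.linear[OF blinfun.bounded_linear_right] upper V(1,4) orth, of u]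
        K by (simp add: divide_le_eq mult.commute)
    moreover have frame_bound: "(\<Sum>v\<in>V. (norm v)\<^sup>2) \<le> n / b\<^sup>2"
    proof -
      have "(norm v)\<^sup>2 \<le> 1 / b\<^sup>2" if v: "v \<in> V" for v
      proof -
        have "norm (X' y v) = 1" using orth[OF v v] by (simp add: norm_eq_sqrt_inner)
        then have "b * norm v \<le> 1" using lower[of v] by simp
        then have "(b * norm v)\<^sup>2 \<le> 1" using b by (simp add: power_le_one)
        then show ?thesis using b by (simp add: power_mult_distrib pos_le_divide_eq mult.commute)
      qed
      then have "(\<Sum>v\<in>V. (norm v)\<^sup>2) \<le> (\<Sum>v\<in>V. 1 / b\<^sup>2)" by (rule sum_mono)
      then show ?thesis by (simp add: V(2) n_def)
    qed
    moreover have "- C * norm (height_gradient e y) \<le> (\<Sum>v\<in>V. blinfun_apply (height_hessian e y v) v)"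
    proof -
      define a where "a = N y \<bullet> e"
      define T where "T = e - a *\<^sub>R N y"
      have T: "norm T \<le> norm (height_gradient e y) / b"
        unfolding T_def a_def by (rule tangential_part_bound[OF y\<Omega> b lower])
      have dev: "norm (N y - s *\<^sub>R e) \<le> 2 * norm T"
        unfolding T_def a_def by (rule normal_deviation_bound[OF y\<Omega> e s nearN[OF y]])
      have "\<bar>a\<bar> \<le> 1"
        using Cauchy_Schwarz_ineq2[of "N y" e] e unit_normal[OF y\<Omega>] by (simp add: a_def)
      then have "\<bar>a * (n * mean_curvature X N y)\<bar> \<le> 1 * (n * \<bar>mean_curvature X N y\<bar>)"
        unfolding abs_mult using n by (intro mult_mono) auto
      also have "\<dots> \<le> 1 * (n * (\<bar>L\<bar> * (2 * norm T)))"
      proof -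
        have "\<bar>mean_curvature X N y\<bar> \<le> L * norm (N y - s *\<^sub>R e)" by (rule curvature[OF nearU[OF y]])
        also have "\<dots> \<le> \<bar>L\<bar> * norm (N y - s *\<^sub>R e)" by (intro mult_right_mono) auto
        also have "\<dots> \<le> \<bar>L\<bar> * (2 * norm T)" using dev by (intro mult_left_mono) auto
        finally show ?thesis using n by simp
      qed
      finally have normal_part: "- (2 * n * \<bar>L\<bar> * norm T) \<le> a * (n * mean_curvature X N y)"
        by (simp add: abs_le_iff mult_ac)
      have "- (M * (norm v)\<^sup>2 * norm T) \<le> X'' y v v \<bullet> T" for v
      proof -
        have "\<bar>X'' y v v \<bullet> T\<bar> \<le> norm (X'' y v v) * norm T" by (rule Cauchy_Schwarz_ineq2)
        also have "\<dots> \<le> (M * (norm v)\<^sup>2) * norm T" by (intro mult_right_mono X''_bound) auto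
        finally show ?thesis by (simp add: abs_le_iff)
      qed
      then have "(\<Sum>v\<in>V. - (M * (norm v)\<^sup>2 * norm T)) \<le> (\<Sum>v\<in>V. X'' y v v \<bullet> T)" by (rule sum_mono)
      moreover have "(\<Sum>v\<in>V. - (M * (norm v)\<^sup>2 * norm T)) = - (M * (\<Sum>v\<in>V. (norm v)\<^sup>2) * norm T)"
        by (simp add: sum_negf sum_distrib_left sum_distrib_right)
      moreover have "M * (\<Sum>v\<in>V. (norm v)\<^sup>2) * norm T \<le> M * (n / b\<^sup>2) * norm T"
        using frame_bound M by (intro mult_right_mono mult_left_mono) auto
      ultimately have tangential_part: "- (M * (n / b\<^sup>2) * norm T) \<le> (\<Sum>v\<in>V. X'' y v v \<bullet> T)" by linarith
      have "blinfun_apply (height_hessian e y v) v = a * (N y \<bullet> X'' y v v) + X'' y v v \<bullet> T" for v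
        by (simp add: height_hessian_def T_def inner_diff_right inner_commute[of "N y"])
      then have hess: "(\<Sum>v\<in>V. blinfun_apply (height_hessian e y v) v)
          = a * (n * mean_curvature X N y) + (\<Sum>v\<in>V. X'' y v v \<bullet> T)"
        by (simp add: sum.distrib n_def flip: sum_distrib_left trace)
      have "C * norm (height_gradient e y) = (2 * n * \<bar>L\<bar> + M * (n / b\<^sup>2)) * (norm (height_gradient e y) / b)"
        by (simp add: C_def)
      also have "\<dots> \<ge> (2 * n * \<bar>L\<bar> + M * (n / b\<^sup>2)) * norm T"
        using T n M b by (intro mult_left_mono) auto
      finally have "2 * n * \<bar>L\<bar> * norm T + M * (n / b\<^sup>2) * norm T \<le> C * norm (height_gradient e y)"
        by (simp add: distrib_right)
      with normal_part tangential_part show ?thesis unfolding hess by linarith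
    qed
    ultimately show "\<exists>V. finite V \<and> (\<forall>u. (1 / K\<^sup>2) * (norm u)\<^sup>2 \<le> (\<Sum>v\<in>V. (u \<bullet> v)\<^sup>2)) \<and>
        (\<Sum>v\<in>V. (norm v)\<^sup>2) \<le> n / b\<^sup>2 \<and>
        - C * norm (height_gradient e y) \<le> (\<Sum>v\<in>V. blinfun_apply (height_hessian e y v) v)"
      using V(1) by blast
  next
    show "1 / K\<^sup>2 > 0" using K by simp
    show "((\<lambda>z. X z \<bullet> e) has_derivative height_gradient e z) (at z)"
        "(height_gradient e has_derivative height_hessian e z) (at z)"
        "X z \<bullet> e \<le> X y0 \<bullet> e" if "z \<in> ball y0 R" for z
      using height_derivatives[OF near\<Omega>[OF that]] max[OF nearU[OF that]] by blast+
    show "y \<in> ball y0 (R / 2)" by (rule that)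
  qed
  moreover have "ball y0 (R / 2) \<subseteq> U"
  proof
    fix y assume "y \<in> ball y0 (R / 2)"
    then have "y \<in> ball y0 R" using R by simp
    then show "y \<in> U" by (rule nearU)
  qed
  ultimately show ?thesis using half_gt_zero[OF R] by blast
qed

end

lemma C1_on_submanifold_lipschitz_at:
  assumes f: "C1_on_submanifold S f" and p: "p \<in> S"
  shows "\<exists>r>0. \<exists>L. \<forall>x\<in>S. norm (x - p) < r \<longrightarrow> norm (f x - f p) \<le> L * norm (x - p)"
proof -
  have "\<exists>U g. open U \<and> p \<in> U \<and> C1_on U g \<and> (\<forall>y\<in>S \<inter> U. g y = f y)"
    using f p by (simp add: C1_on_submanifold_def)
  then obtain U g where U: "open U" "p \<in> U" and gf: "\<forall>y\<in>S \<inter> U. g y = f y" and "C1_on U g"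
    by (elim exE conjE) (rule that)
  from \<open>C1_on U g\<close> obtain g' where g: "\<And>x. x \<in> U \<Longrightarrow> (g has_derivative blinfun_apply (g' x)) (at x)"
      and g': "continuous_on U g'"
    unfolding C1_on_def by blast
  have "isCont g' p" using g' U by (simp add: continuous_on_eq_continuous_at)
  then have "\<forall>\<^sub>F x in nhds p. dist (g' x) (g' p) < 1"
    by (simp add: isCont_def tendsto_at_iff_tendsto_nhds tendstoD)
  moreover have "\<forall>\<^sub>F x in nhds p. x \<in> U" using U by (simp add: eventually_nhds_in_open)
  ultimately have "\<forall>\<^sub>F x in nhds p. dist (g' x) (g' p) < 1 \<and> x \<in> U" by (rule eventually_conj)
  then obtain r where r: "r > 0" and nearp: "\<And>x. dist x p < r \<Longrightarrow> dist (g' x) (g' p) < 1 \<and> x \<in> U"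
    unfolding eventually_nhds_metric by blast
  have "norm (f x - f p) \<le> (norm (g' p) + 1) * norm (x - p)" if x: "x \<in> S" "norm (x - p) < r" for x
  proof -
    have "norm (g x - g p) \<le> (norm (g' p) + 1) * norm (x - p)"
    proof (rule differentiable_bound[of "ball p r" g "\<lambda>z. blinfun_apply (g' z)"])
      fix z assume z: "z \<in> ball p r"
      then show "(g has_derivative blinfun_apply (g' z)) (at z within ball p r)"
        using nearp[of z] g by (auto simp: dist_commute intro: has_derivative_at_withinI)
      show "onorm (blinfun_apply (g' z)) \<le> norm (g' p) + 1"
        using nearp[of z] z norm_triangle_sub[of "g' z" "g' p"] norm_minus_commute[of "g' z" "g' p"]
        by (simp add: dist_commute dist_norm flip: norm_blinfun.rep_eq)
    qed (use x r in \<open>auto simp: dist_norm norm_minus_commute\<close>)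
    moreover have "g x = f x" "g p = f p"
      using gf nearp x p U by (auto simp: dist_norm)
    ultimately show ?thesis by simp
  qed
  then show ?thesis using r by blast
qed

section \<open>Charts\<close>

lemma manifold_chart_at:
  fixes A :: "('a, 'n::finite) chart set"
  assumes A: "C2_manifold M A" and p: "p \<in> topspace M"
  obtains U \<phi> where "(U, \<phi>) \<in> A" "p \<in> U" "U \<subseteq> topspace M" "openin M U" "open (\<phi> ` U)" "inj_on \<phi> U"
    "\<And>W. openin M W \<Longrightarrow> open (\<phi> ` (U \<inter> W))"
    "\<And>W. open W \<Longrightarrow> W \<subseteq> \<phi> ` U \<Longrightarrow> openin M (U \<inter> \<phi> -` W)"
proof -
  have "p \<in> (\<Union>c\<in>A. fst c)" using A p unfolding C2_manifold_def by argo
  then obtain c where "c \<in> A" "p \<in> fst c" by blast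
  then obtain U \<phi> where c: "(U, \<phi>) \<in> A" "p \<in> U" by (cases c) simp
  have "\<forall>c\<in>A. is_chart M c" using A unfolding C2_manifold_def by argo
  then have "is_chart M (U, \<phi>)" using c by blast
  then have U: "openin M U" "open (\<phi> ` U)"
    and hom: "homeomorphic_map (subtopology M U) (top_of_set (\<phi> ` U)) \<phi>"
    by (simp_all add: is_chart_def)
  have UM: "U \<subseteq> topspace M" using openin_subset[OF U(1)] .
  then have top: "topspace (subtopology M U) = U" by (simp add: topspace_subtopology Int_absorb1)
  have inj: "inj_on \<phi> U"
    using homeomorphic_imp_injective_map[OF hom] unfolding top .
  have op: "open (\<phi> ` (U \<inter> W))" if "openin M W" for W
  proof -
    have "openin (top_of_set (\<phi> ` U)) (\<phi> ` (U \<inter> W))"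
      using homeomorphic_imp_open_map[OF hom] openin_subtopology_Int2[OF that]
      by (simp add: open_map_def)
    then show ?thesis using openin_open_eq[OF U(2)] by blast
  qed
  have pre: "openin M (U \<inter> \<phi> -` W)" if "open W" "W \<subseteq> \<phi> ` U" for W
  proof -
    have "openin (top_of_set (\<phi> ` U)) W" using that by (simp add: open_openin_trans open_subset)
    then have "openin (subtopology M U) {z \<in> topspace (subtopology M U). \<phi> z \<in> W}"
      by (rule openin_continuous_map_preimage[OF homeomorphic_imp_continuous_map[OF hom]])
    then have "openin M {z \<in> topspace (subtopology M U). \<phi> z \<in> W}"
      by (rule openin_trans_full[OF _ U(1)])
    moreover have "{z \<in> topspace (subtopology M U). \<phi> z \<in> W} = U \<inter> \<phi> -` W" unfolding top by auto
    ultimately show ?thesis by simp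
  qed
  show thesis by (rule that[OF c UM U inj op pre])
qed

lemma in_chart_apply: "inj_on \<phi> U \<Longrightarrow> q \<in> U \<Longrightarrow> in_chart (U, \<phi>) f (\<phi> q) = f q"
  by (simp add: in_chart_def)

lemma continuous_map_of_charts:
  fixes A :: "('a, 'n::finite) chart set" and f :: "'a \<Rightarrow> 'b::real_normed_vector"
  assumes A: "C2_manifold M A" and f: "\<And>U \<phi>. (U, \<phi>) \<in> A \<Longrightarrow> continuous_on (\<phi> ` U) (in_chart (U, \<phi>) f)"
  shows "continuous_map M euclidean f"
proof -
  have "openin M {x \<in> topspace M. f x \<in> W}" if W: "open W" for W
  proof (subst openin_subopen, intro ballI)
    fix x assume "x \<in> {x \<in> topspace M. f x \<in> W}"
    then have x: "x \<in> topspace M" "f x \<in> W" by auto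
    obtain U \<phi> where c: "(U, \<phi>) \<in> A" "x \<in> U" "U \<subseteq> topspace M" "openin M U" "open (\<phi> ` U)" "inj_on \<phi> U"
        and pre: "\<And>W. open W \<Longrightarrow> W \<subseteq> \<phi> ` U \<Longrightarrow> openin M (U \<inter> \<phi> -` W)"
      by (rule manifold_chart_at[OF A x(1)]) (rule that)
    have "openin M (U \<inter> \<phi> -` (\<phi> ` U \<inter> in_chart (U, \<phi>) f -` W))"
      by (intro pre continuous_open_preimage f c W) auto
    moreover have "U \<inter> \<phi> -` (\<phi> ` U \<inter> in_chart (U, \<phi>) f -` W) = {z \<in> U. in_chart (U, \<phi>) f (\<phi> z) \<in> W}"
      by blast
    moreover have "\<dots> = {z \<in> U. f z \<in> W}"
      by (simp add: in_chart_apply[OF c(6)] cong: conj_cong)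
    ultimately have "openin M {z \<in> U. f z \<in> W}" by simp
    then show "\<exists>T. openin M T \<and> x \<in> T \<and> T \<subseteq> {x \<in> topspace M. f x \<in> W}"
      using x c by (intro exI[of _ "{z \<in> U. f z \<in> W}"]) auto
  qed
  then show ?thesis by (simp add: continuous_map)
qed

lemma chart_patch:
  fixes A :: "('a, 'n::finite) chart set" and \<psi> \<eta> :: "'a \<Rightarrow> real ^ 'm::finite"
  assumes h: "immersed_oriented_hypersurface M A \<psi> \<eta>" and c: "(U, \<phi>) \<in> A"
  obtains X' N' X'' where
    "hypersurface_patch (\<phi> ` U) (in_chart (U, \<phi>) \<psi>) (in_chart (U, \<phi>) \<eta>) X' N' X''"
proof -
  let ?X = "in_chart (U, \<phi>) \<psi>" and ?N = "in_chart (U, \<phi>) \<eta>"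
  have card: "CARD('m) = CARD('n) + 1" and A: "C2_manifold M A" and im: "C2_immersion A \<psi>"
    and ga: "is_gauss_map M A \<psi> \<eta>"
    using h by (auto simp: immersed_oriented_hypersurface_def)
  have "\<forall>c\<in>A. is_chart M c" using A unfolding C2_manifold_def by argo
  then have "is_chart M (U, \<phi>)" using c by blast
  then have U: "openin M U" "open (\<phi> ` U)" by (simp_all add: is_chart_def)
  have UM: "U \<subseteq> topspace M" using openin_subset[OF U(1)] .
  have "\<forall>(U, \<phi>)\<in>A. C2_on (\<phi> ` U) (in_chart (U, \<phi>) \<psi>) \<and>
      (\<forall>y\<in>\<phi> ` U. inj (frechet_derivative (in_chart (U, \<phi>) \<psi>) (at y)))"
    using im unfolding C2_immersion_def .
  from bspec[OF this c] have C2: "C2_on (\<phi> ` U) ?X"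
    and inj: "\<forall>y\<in>\<phi> ` U. inj (frechet_derivative ?X (at y))" by simp_all
  from C2 obtain X' where X: "\<forall>y\<in>\<phi> ` U. (?X has_derivative blinfun_apply (X' y)) (at y)"
      and "C1_on (\<phi> ` U) X'"
    unfolding C2_on_def by (elim exE conjE) (rule that)
  then obtain X'' where X': "\<forall>y\<in>\<phi> ` U. (X' has_derivative blinfun_apply (X'' y)) (at y)"
      and X'': "continuous_on (\<phi> ` U) X''"
    unfolding C1_on_def by (elim exE conjE) (rule that)
  have sphere: "\<eta> ` topspace M \<subseteq> sphere 0 1" using ga unfolding is_gauss_map_def by argo
  have "\<forall>(U, \<phi>)\<in>A. C1_on (\<phi> ` U) (in_chart (U, \<phi>) \<eta>) \<and>
        (\<forall>y\<in>\<phi> ` U. \<forall>v.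
           in_chart (U, \<phi>) \<eta> y \<bullet> frechet_derivative (in_chart (U, \<phi>) \<psi>) (at y) v = 0)"
    using ga unfolding is_gauss_map_def by argo
  from bspec[OF this c] have C1: "C1_on (\<phi> ` U) ?N"
    and orth: "\<forall>y\<in>\<phi> ` U. \<forall>v. ?N y \<bullet> frechet_derivative ?X (at y) v = 0" by simp_all
  from C1 obtain N' where N: "\<forall>y\<in>\<phi> ` U. (?N has_derivative blinfun_apply (N' y)) (at y)"
    unfolding C1_on_def by (elim exE conjE) (rule that)
  have fd: "frechet_derivative ?X (at y) = blinfun_apply (X' y)" if "y \<in> \<phi> ` U" for y
    using frechet_derivative_at[OF bspec[OF X that]] by simp
  have "hypersurface_patch (\<phi> ` U) ?X ?N X' N' X''"
  proof
    fix y assume y: "y \<in> \<phi> ` U"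
    show "(?X has_derivative blinfun_apply (X' y)) (at y)" using X y by (rule bspec)
    show "(X' has_derivative blinfun_apply (X'' y)) (at y)" using X' y by (rule bspec)
    show "(?N has_derivative blinfun_apply (N' y)) (at y)" using N y by (rule bspec)
    show "inj (blinfun_apply (X' y))" using bspec[OF inj y] by (simp add: fd[OF y])
    show "?N y \<bullet> blinfun_apply (X' y) v = 0" for v using bspec[OF orth y] by (simp add: fd[OF y])
    have "inv_into U \<phi> y \<in> topspace M" using UM inv_into_into[OF y] by blast
    then have "\<eta> (inv_into U \<phi> y) \<in> sphere 0 1" using sphere by blast
    then show "norm (?N y) = 1" by (simp add: in_chart_def)
  qed (rule card U(2) X'')+
  then show thesis by (rule that)
qed

lemma chart_at:
  fixes A :: "('a, 'n::finite) chart set" and \<psi> \<eta> :: "'a \<Rightarrow> real ^ 'm::finite"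
  assumes h: "immersed_oriented_hypersurface M A \<psi> \<eta>" and p: "p \<in> topspace M"
  obtains U \<phi> X' N' X'' where "(U, \<phi>) \<in> A" "p \<in> U" "U \<subseteq> topspace M" "openin M U"
    "hypersurface_patch (\<phi> ` U) (in_chart (U, \<phi>) \<psi>) (in_chart (U, \<phi>) \<eta>) X' N' X''"
    "\<And>W. openin M W \<Longrightarrow> open (\<phi> ` (U \<inter> W))"
    "\<And>W. open W \<Longrightarrow> W \<subseteq> \<phi> ` U \<Longrightarrow> openin M (U \<inter> \<phi> -` W)"
    "\<And>q. q \<in> U \<Longrightarrow> in_chart (U, \<phi>) \<psi> (\<phi> q) = \<psi> q"
    "\<And>q. q \<in> U \<Longrightarrow> in_chart (U, \<phi>) \<eta> (\<phi> q) = \<eta> q"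
proof -
  have A: "C2_manifold M A" using h by (simp add: immersed_oriented_hypersurface_def)
  obtain U \<phi> where c: "(U, \<phi>) \<in> A" "p \<in> U" "U \<subseteq> topspace M" "openin M U" "open (\<phi> ` U)" "inj_on \<phi> U"
      "\<And>W. openin M W \<Longrightarrow> open (\<phi> ` (U \<inter> W))"
      "\<And>W. open W \<Longrightarrow> W \<subseteq> \<phi> ` U \<Longrightarrow> openin M (U \<inter> \<phi> -` W)"
    by (rule manifold_chart_at[OF A p]) (rule that)
  obtain X' N' X'' where patch:
    "hypersurface_patch (\<phi> ` U) (in_chart (U, \<phi>) \<psi>) (in_chart (U, \<phi>) \<eta>) X' N' X''"
    using chart_patch[OF h c(1)] .
  show thesis by (rule that[OF c(1-4) patch c(7,8) in_chart_apply[OF c(6)] in_chart_apply[OF c(6)]])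
qed

lemma immersed_hypersurface_continuous:
  fixes A :: "('a, 'n::finite) chart set" and \<psi> \<eta> :: "'a \<Rightarrow> real ^ 'm::finite"
  assumes h: "immersed_oriented_hypersurface M A \<psi> \<eta>"
  shows "continuous_map M euclidean \<psi>" and "continuous_map M euclidean \<eta>"
proof -
  have A: "C2_manifold M A" using h by (simp add: immersed_oriented_hypersurface_def)
  have "continuous_on (\<phi> ` U) (in_chart (U, \<phi>) \<psi>) \<and> continuous_on (\<phi> ` U) (in_chart (U, \<phi>) \<eta>)"
    if c: "(U, \<phi>) \<in> A" for U \<phi>
  proof (rule chart_patch[OF h c])
    fix X' N' X''
    assume "hypersurface_patch (\<phi> ` U) (in_chart (U, \<phi>) \<psi>) (in_chart (U, \<phi>) \<eta>) X' N' X''"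
    then interpret hypersurface_patch "\<phi> ` U" "in_chart (U, \<phi>) \<psi>" "in_chart (U, \<phi>) \<eta>" X' N' X'' .
    show ?thesis
      by (intro conjI continuous_at_imp_continuous_on ballI)
        (rule has_derivative_continuous[OF X], assumption, rule has_derivative_continuous[OF N], assumption)
  qed
  then show "continuous_map M euclidean \<psi>" "continuous_map M euclidean \<eta>"
    using continuous_map_of_charts[OF A] by blast+
qed

section \<open>Highest points of compact hypersurfaces\<close>

lemma gauss_map_at_height_max:
  fixes A :: "('a, 'n::finite) chart set" and \<psi> \<eta> :: "'a \<Rightarrow> real ^ 'm::finite"
  assumes h: "immersed_oriented_hypersurface M A \<psi> \<eta>"
    and K: "openin M K" "p \<in> K" and max: "\<And>q. q \<in> K \<Longrightarrow> \<psi> q \<bullet> e \<le> \<psi> p \<bullet> e" and e: "norm e = 1"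
  shows "\<eta> p = e \<or> \<eta> p = - e"
proof -
  have p: "p \<in> topspace M" using K openin_subset by blast
  show ?thesis
  proof (rule chart_at[OF h p])
    fix U \<phi> X' N' X''
    assume c: "p \<in> U"
      and patch: "hypersurface_patch (\<phi> ` U) (in_chart (U, \<phi>) \<psi>) (in_chart (U, \<phi>) \<eta>) X' N' X''"
      and op: "\<And>W. openin M W \<Longrightarrow> open (\<phi> ` (U \<inter> W))"
      and \<psi>: "\<And>q. q \<in> U \<Longrightarrow> in_chart (U, \<phi>) \<psi> (\<phi> q) = \<psi> q"
      and \<eta>: "\<And>q. q \<in> U \<Longrightarrow> in_chart (U, \<phi>) \<eta> (\<phi> q) = \<eta> q"
    have "in_chart (U, \<phi>) \<eta> (\<phi> p) = e \<or> in_chart (U, \<phi>) \<eta> (\<phi> p) = - e"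
      by (rule hypersurface_patch.normal_at_height_max[OF patch op[OF K(1)]])
        (use c K(2) max e in \<open>auto simp: \<psi>\<close>)
    then show ?thesis by (simp add: \<eta> c)
  qed
qed

lemma prescribed_curvature_sign_at_height_max:
  fixes A :: "('a, 'n::finite) chart set" and \<psi> \<eta> :: "'a \<Rightarrow> real ^ 'm::finite"
  assumes h: "prescribed_mean_curvature_hypersurface \<H> M A \<psi> \<eta>"
    and p: "p \<in> topspace M" and max: "\<And>q. q \<in> topspace M \<Longrightarrow> \<psi> q \<bullet> (s *\<^sub>R \<eta> p) \<le> \<psi> p \<bullet> (s *\<^sub>R \<eta> p)"
  shows "s * \<H> (\<eta> p) \<le> 0"
proof -
  have h': "immersed_oriented_hypersurface M A \<psi> \<eta>"
    and mc: "\<And>U \<phi> p. (U, \<phi>) \<in> A \<Longrightarrow> p \<in> U \<Longrightarrow>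
      mean_curvature (in_chart (U, \<phi>) \<psi>) (in_chart (U, \<phi>) \<eta>) (\<phi> p) = \<H> (\<eta> p)"
    using h by (auto simp: prescribed_mean_curvature_hypersurface_def)
  show ?thesis
  proof (rule chart_at[OF h' p])
    fix U \<phi> X' N' X''
    assume c: "(U, \<phi>) \<in> A" "p \<in> U" "U \<subseteq> topspace M" "openin M U"
      and patch: "hypersurface_patch (\<phi> ` U) (in_chart (U, \<phi>) \<psi>) (in_chart (U, \<phi>) \<eta>) X' N' X''"
      and op: "\<And>W. openin M W \<Longrightarrow> open (\<phi> ` (U \<inter> W))"
      and \<psi>: "\<And>q. q \<in> U \<Longrightarrow> in_chart (U, \<phi>) \<psi> (\<phi> q) = \<psi> q"
      and \<eta>: "\<And>q. q \<in> U \<Longrightarrow> in_chart (U, \<phi>) \<eta> (\<phi> q) = \<eta> q"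
    have "s * mean_curvature (in_chart (U, \<phi>) \<psi>) (in_chart (U, \<phi>) \<eta>) (\<phi> p) \<le> 0"
      by (rule hypersurface_patch.mean_curvature_sign_at_height_max[OF patch op[OF c(4)]])
        (use c max in \<open>auto simp: \<psi> \<eta>\<close>)
    then show ?thesis by (simp add: mc c)
  qed
qed

text \<open>The patch is restricted to the points whose normal is so close to \<open>\<eta> p\<close> that the Lipschitz estimate
  for \<open>\<H>\<close> is available.\<close>

lemma height_locally_constant_at_max:
  fixes A :: "('a, 'n::finite) chart set" and \<psi> \<eta> :: "'a \<Rightarrow> real ^ 'm::finite"
  assumes h: "prescribed_mean_curvature_hypersurface \<H> M A \<psi> \<eta>"
    and \<H>: "C1_on_submanifold (sphere 0 1) \<H>"
    and p: "p \<in> topspace M" and max: "\<And>q. q \<in> topspace M \<Longrightarrow> \<psi> q \<bullet> e \<le> \<psi> p \<bullet> e"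
    and e: "norm e = 1" and zero: "\<H> (\<eta> p) = 0"
  shows "\<exists>W. openin M W \<and> p \<in> W \<and> (\<forall>q\<in>W. \<psi> q \<bullet> e = \<psi> p \<bullet> e)"
proof -
  have h': "immersed_oriented_hypersurface M A \<psi> \<eta>"
    and mc: "\<And>U \<phi> p. (U, \<phi>) \<in> A \<Longrightarrow> p \<in> U \<Longrightarrow>
      mean_curvature (in_chart (U, \<phi>) \<psi>) (in_chart (U, \<phi>) \<eta>) (\<phi> p) = \<H> (\<eta> p)"
    using h by (auto simp: prescribed_mean_curvature_hypersurface_def)
  have "\<eta> p = e \<or> \<eta> p = - e"
    by (rule gauss_map_at_height_max[OF h' openin_topspace p]) (use max e in auto)
  then obtain s where s: "\<bar>s\<bar> = 1" "\<eta> p = s *\<^sub>R e"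
    by (metis abs_1 abs_minus_cancel scaleR_minus1_left scaleR_one)
  have unit: "norm (\<eta> q) = 1" if "q \<in> topspace M" for q
    using h' that by (auto simp: immersed_oriented_hypersurface_def is_gauss_map_def)
  have "\<eta> p \<in> sphere 0 1" using unit[OF p] by simp
  from C1_on_submanifold_lipschitz_at[OF \<H> this] obtain r L where r: "r > 0" and
    "\<forall>x\<in>sphere 0 1. norm (x - \<eta> p) < r \<longrightarrow> norm (\<H> x - \<H> (\<eta> p)) \<le> L * norm (x - \<eta> p)"
    by blast
  then have lip: "\<bar>\<H> x\<bar> \<le> L * norm (x - \<eta> p)" if "norm x = 1" "norm (x - \<eta> p) < r" for x
    using that zero by simp
  show ?thesis
  proof (rule chart_at[OF h' p])
    fix U \<phi> X' N' X''
    assume c: "(U, \<phi>) \<in> A" "p \<in> U" "U \<subseteq> topspace M" "openin M U"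
      and patch: "hypersurface_patch (\<phi> ` U) (in_chart (U, \<phi>) \<psi>) (in_chart (U, \<phi>) \<eta>) X' N' X''"
      and op: "\<And>W. openin M W \<Longrightarrow> open (\<phi> ` (U \<inter> W))"
      and pre: "\<And>W. open W \<Longrightarrow> W \<subseteq> \<phi> ` U \<Longrightarrow> openin M (U \<inter> \<phi> -` W)"
      and \<psi>: "\<And>q. q \<in> U \<Longrightarrow> in_chart (U, \<phi>) \<psi> (\<phi> q) = \<psi> q"
      and \<eta>: "\<And>q. q \<in> U \<Longrightarrow> in_chart (U, \<phi>) \<eta> (\<phi> q) = \<eta> q"
    let ?X = "in_chart (U, \<phi>) \<psi>" and ?N = "in_chart (U, \<phi>) \<eta>"
    interpret hypersurface_patch "\<phi> ` U" ?X ?N X' N' X'' by (rule patch)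
    define \<Omega> where "\<Omega> = \<phi> ` U \<inter> ?N -` ball (\<eta> p) r"
    have cN: "continuous_on (\<phi> ` U) ?N"
      by (intro continuous_at_imp_continuous_on ballI has_derivative_continuous[OF N])
    have "\<exists>R>0. ball (\<phi> p) R \<subseteq> \<Omega> \<and> (\<forall>y\<in>ball (\<phi> p) R. ?X y \<bullet> e = ?X (\<phi> p) \<bullet> e)"
    proof (rule height_constant_near_max[where s = s and L = L])
      show "open \<Omega>" unfolding \<Omega>_def
        using continuous_open_preimage[OF cN open_domain open_ball] .
      show "\<bar>mean_curvature ?X ?N y\<bar> \<le> L * norm (?N y - s *\<^sub>R e)" if y: "y \<in> \<Omega>" for y
      proof -
        obtain q where q: "q \<in> U" "y = \<phi> q" using y by (auto simp: \<Omega>_def)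
        then have "q \<in> topspace M" "norm (\<eta> q - \<eta> p) < r"
          using y c by (auto simp: \<Omega>_def \<eta> dist_norm norm_minus_commute)
        then show ?thesis using lip[of "\<eta> q"] unit q c by (simp add: mc \<eta> flip: s(2))
      qed
    qed (use c r max e s in \<open>auto simp: \<Omega>_def \<psi> \<eta>\<close>)
    then obtain R where R: "R > 0" "ball (\<phi> p) R \<subseteq> \<phi> ` U" "\<forall>y\<in>ball (\<phi> p) R. ?X y \<bullet> e = ?X (\<phi> p) \<bullet> e"
      by (auto simp: \<Omega>_def)
    have "openin M (U \<inter> \<phi> -` ball (\<phi> p) R)" using R by (intro pre) auto
    moreover have "\<psi> q \<bullet> e = \<psi> p \<bullet> e" if "q \<in> U \<inter> \<phi> -` ball (\<phi> p) R" for q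
      using R(3) that c by (force simp: \<psi>)
    moreover have "p \<in> U \<inter> \<phi> -` ball (\<phi> p) R" using R(1) c(2) by simp
    ultimately show ?thesis by blast
  qed
qed

lemma gauss_map_at_global_height_max_sign:
  fixes A :: "('a, 'n::finite) chart set" and \<psi> \<eta> :: "'a \<Rightarrow> real ^ 'm::finite"
  assumes h: "prescribed_mean_curvature_hypersurface \<H> M A \<psi> \<eta>"
    and p: "p \<in> topspace M" and max: "\<And>q. q \<in> topspace M \<Longrightarrow> \<psi> q \<bullet> e \<le> \<psi> p \<bullet> e"
    and e: "norm e = 1"
  shows "\<eta> p = e \<and> \<H> e \<le> 0 \<or> \<eta> p = - e \<and> 0 \<le> \<H> (- e)"
proof -
  have h': "immersed_oriented_hypersurface M A \<psi> \<eta>"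
    using h by (simp add: prescribed_mean_curvature_hypersurface_def)
  have "\<eta> p = e \<or> \<eta> p = - e"
    by (rule gauss_map_at_height_max[OF h' openin_topspace p]) (use max e in auto)
  then show ?thesis
  proof
    assume "\<eta> p = e"
    then show ?thesis
      using prescribed_curvature_sign_at_height_max[OF h p, of 1] max by simp
  next
    assume "\<eta> p = - e"
    then show ?thesis
      using prescribed_curvature_sign_at_height_max[OF h p, of "-1"] max by simp
  qed
qed

text \<open>The maximum set \<open>K\<close> is restricted to one value of \<open>\<eta>\<close>: \<open>\<H>\<close> is known to vanish at \<open>\<eta> p\<close> only, so the
  maximum principle gives no information at points with the opposite normal.  Openness survives, because
  \<open>\<eta>\<close> is continuous and takes only the values \<open>\<plusminus> e\<close> on the maximum set.\<close>

lemma no_height_max_with_zero_curvature: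
  fixes A :: "('a, 'n::finite) chart set" and \<psi> \<eta> :: "'a \<Rightarrow> real ^ 'm::finite"
  assumes compact: "compact_space M"
    and h: "prescribed_mean_curvature_hypersurface \<H> M A \<psi> \<eta>"
    and \<H>: "C1_on_submanifold (sphere 0 1) \<H>"
    and p: "p \<in> topspace M" and max: "\<And>q. q \<in> topspace M \<Longrightarrow> \<psi> q \<bullet> e \<le> \<psi> p \<bullet> e"
    and e: "norm e = 1" and zero: "\<H> (\<eta> p) = 0"
  shows False
proof -
  have h': "immersed_oriented_hypersurface M A \<psi> \<eta>"
    using h by (simp add: prescribed_mean_curvature_hypersurface_def)
  have cont: "continuous_map M euclidean \<psi>" "continuous_map M euclidean \<eta>"
    using immersed_hypersurface_continuous[OF h'] by blast+
  have normal: "\<eta> q = e \<or> \<eta> q = - e" if "q \<in> topspace M" "\<psi> q \<bullet> e = \<psi> p \<bullet> e" for q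
    by (rule gauss_map_at_height_max[OF h' openin_topspace that(1)]) (use max e that in auto)
  have np: "norm (\<eta> p) = 1" using normal[OF p] e by auto
  have cont_height: "continuous_map M euclideanreal (\<lambda>q. \<psi> q \<bullet> u)" for u
    using continuous_map_compose[OF cont(1), of euclideanreal "\<lambda>x. x \<bullet> u"]
    by (simp add: comp_def continuous_on_inner continuous_on_id continuous_on_const)
  define K where "K = {q \<in> topspace M. \<psi> q \<bullet> e \<in> {\<psi> p \<bullet> e}} \<inter> {q \<in> topspace M. \<eta> q \<in> {\<eta> p}}"
  have "closedin M K"
    unfolding K_def
    by (intro closedin_Int closedin_continuous_map_preimage[OF cont_height] closedin_continuous_map_preimage[OF cont(2)]) auto
  then have compactK: "compactin M K" by (rule closedin_compact_space[OF compact])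
  have openK: "openin M K"
  proof (subst openin_subopen, intro ballI)
    fix q assume "q \<in> K"
    then have q: "q \<in> topspace M" "\<psi> q \<bullet> e = \<psi> p \<bullet> e" "\<eta> q = \<eta> p" by (auto simp: K_def)
    have "\<exists>W. openin M W \<and> q \<in> W \<and> (\<forall>x\<in>W. \<psi> x \<bullet> e = \<psi> q \<bullet> e)"
      by (rule height_locally_constant_at_max[OF h \<H> q(1) _ e]) (use q max zero in auto)
    then obtain W where W: "openin M W" "q \<in> W" "\<forall>x\<in>W. \<psi> x \<bullet> e = \<psi> q \<bullet> e" by blast
    define O' where "O' = {x \<in> topspace M. \<eta> x \<in> ball (\<eta> p) 1}"
    have O': "openin M O'"
      unfolding O'_def by (rule openin_continuous_map_preimage[OF cont(2)]) simp
    have "x \<in> K" if x: "x \<in> W \<inter> O'" for x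
    proof -
      have xM: "x \<in> topspace M" and hx: "\<psi> x \<bullet> e = \<psi> p \<bullet> e" and d: "norm (\<eta> p - \<eta> x) < 1"
        using x W(3) q(2) by (auto simp: O'_def dist_norm)
      have "\<eta> x = \<eta> p \<or> \<eta> x = - \<eta> p" using normal[OF xM hx] normal[OF p refl] by auto
      moreover have "\<eta> x \<noteq> - \<eta> p"
      proof
        assume "\<eta> x = - \<eta> p"
        then have "norm (2 *\<^sub>R \<eta> p) < 1" using d by (simp add: scaleR_2)
        then show False using np by simp
      qed
      ultimately show ?thesis using xM hx by (simp add: K_def)
    qed
    moreover have "openin M (W \<inter> O')" using W(1) O' by (rule openin_Int)
    moreover have "q \<in> W \<inter> O'" using W(2) q by (simp add: O'_def)
    ultimately show "\<exists>T. openin M T \<and> q \<in> T \<and> T \<subseteq> K" by blast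
  qed
  have "CARD('m) = CARD('n) + 1" using h' by (simp add: immersed_oriented_hypersurface_def)
  then have "2 \<le> DIM(real ^ 'm)" using zero_less_card_finite[where 'a = 'n] by simp
  then obtain u0 where u0: "u0 \<noteq> 0" "orthogonal e u0" using orthogonal_to_vector_exists[of e] by blast
  define u where "u = u0 /\<^sub>R norm u0"
  have u: "norm u = 1" "e \<bullet> u = 0" using u0 by (simp_all add: u_def orthogonal_def)
  have "compact ((\<lambda>q. \<psi> q \<bullet> u) ` K)"
    using image_compactin[OF compactK cont_height] by simp
  moreover have "K \<noteq> {}" using p by (auto simp: K_def)
  ultimately obtain q where q: "q \<in> K" "\<And>x. x \<in> K \<Longrightarrow> \<psi> x \<bullet> u \<le> \<psi> q \<bullet> u"
    using compact_attains_sup[of "(\<lambda>q. \<psi> q \<bullet> u) ` K"] by auto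
  have "\<eta> q = u \<or> \<eta> q = - u"
    by (rule gauss_map_at_height_max[OF h' openK q u(1)])
  moreover have "\<eta> q = e \<or> \<eta> q = - e"
    using q(1) normal[OF p refl] by (auto simp: K_def)
  ultimately have "e = u \<or> e = - u" by auto
  then show False using u by auto
qed

theorem proposition2p6:
  fixes \<H> :: "real ^ 'm::finite \<Rightarrow> real" and x0 :: "real ^ 'm"
  assumes "CARD('m) = CARD('n::finite) + 1"
    and "C1_on_submanifold (sphere 0 1) \<H>"
    and "x0 \<in> sphere 0 1" and "\<H> x0 = 0"
  shows "\<not> (\<exists>(M :: 'a topology) (A :: ('a, 'n) chart set) \<psi> \<eta>.
    compact_space M \<and> prescribed_mean_curvature_hypersurface \<H> M A \<psi> \<eta>)"
proof (intro notI, elim exE conjE)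
  fix M :: "'a topology" and A :: "('a, 'n) chart set" and \<psi> \<eta>
  assume compact: "compact_space M" and h: "prescribed_mean_curvature_hypersurface \<H> M A \<psi> \<eta>"
  have h': "immersed_oriented_hypersurface M A \<psi> \<eta>"
    using h by (simp add: prescribed_mean_curvature_hypersurface_def)
  have x0: "norm x0 = 1" using assms(3) by simp
  have max: "\<exists>p\<in>topspace M. \<forall>q\<in>topspace M. \<psi> q \<bullet> e \<le> \<psi> p \<bullet> e" for e
  proof -
    have "continuous_map M euclideanreal (\<lambda>q. \<psi> q \<bullet> e)"
      using continuous_map_compose[OF immersed_hypersurface_continuous(1)[OF h'], of euclideanreal "\<lambda>x. x \<bullet> e"]
      by (simp add: comp_def continuous_on_inner continuous_on_id continuous_on_const)
    then have "compact ((\<lambda>q. \<psi> q \<bullet> e) ` topspace M)"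
      using image_compactin[of M "topspace M" euclideanreal] compact by (simp add: compact_space_def)
    moreover have "topspace M \<noteq> {}" using h' by (simp add: immersed_oriented_hypersurface_def)
    ultimately show ?thesis
      using compact_attains_sup[of "(\<lambda>q. \<psi> q \<bullet> e) ` topspace M"] by auto
  qed
  obtain p where p: "p \<in> topspace M" "\<And>q. q \<in> topspace M \<Longrightarrow> \<psi> q \<bullet> x0 \<le> \<psi> p \<bullet> x0"
    using max by blast
  \<comment> \<open>A highest point for \<open>- x0\<close> is a lowest point for \<open>x0\<close>.\<close>
  obtain p' where p': "p' \<in> topspace M" "\<And>q. q \<in> topspace M \<Longrightarrow> \<psi> q \<bullet> (- x0) \<le> \<psi> p' \<bullet> (- x0)"
    using max by blast
  have x0': "norm (- x0) = 1" using x0 by simp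
  have "\<H> (\<eta> p) \<noteq> 0"
    using no_height_max_with_zero_curvature[OF compact h assms(2) p x0] by blast
  moreover have "\<H> (\<eta> p') \<noteq> 0"
    using no_height_max_with_zero_curvature[OF compact h assms(2) p' x0'] by blast
  moreover have "\<eta> p = x0 \<and> \<H> x0 \<le> 0 \<or> \<eta> p = - x0 \<and> 0 \<le> \<H> (- x0)"
    by (rule gauss_map_at_global_height_max_sign[OF h p x0])
  moreover have "\<eta> p' = - x0 \<and> \<H> (- x0) \<le> 0 \<or> \<eta> p' = x0 \<and> 0 \<le> \<H> x0"
    using gauss_map_at_global_height_max_sign[OF h p' x0'] by simp
  ultimately show False using assms(4) by auto
qed

end
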